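(* In general, the maximum of $|\det A|$ over $n\times n$ circulant matrices $A$ with real entries in $[-1,1]$ is not attained at an extreme point of the cube $[-1,1]^n$ of first rows. Specifically: (1) For $n=9$, let $A(\varepsilon) := \mathrm{circ}(1-\varepsilon,1,-1,1,-1,-1,1,1,1)$. Then $\det A(\varepsilon) = 6912 + 4608\,\varepsilon + O(\varepsilon^2)$ as $\varepsilon \to 0$, $D_{\pm1}(9) = 6912$, and $\det A(1) = 8582 > 6912$. (2) For $n=10$, $D_{\pm 1}(10) = 22528$, and as $\varepsilon\to 0$, $$\det\mathrm{circ}(1-\varepsilon,-1,1,1,-1,-1,-1,-1,-1,-1) = -(22528 + 2560\,\varepsilon + O(\varepsilon^2)),$$ $$\det\mathrm{circ}(-1+\varepsilon,-1,-1,1,-1,1,1,-1,-1,-1) = 22528 + 7680\,\varepsilon + O(\varepsilon^2).$$ Moreover, for $A(x) := \mathrm{circ}(x,-1,1,-1,1,1,-1,-1,-1,-1)$, $\det A(x)$ is an even polynomial in $x$ and $-\det A(0) = 33489 > -\det A(\pm1) = 22528 = D_{\pm1}(10)$. (3) For $n=22$, let $A(x) := \mathrm{circ}(x,-1,1,1,-1,-1,-1,-1,-1,-1,-1,1,1,-1,1,-1,1,-1,1,1,-1,-1)$. Then $-\det A(0) = 216409254831025 > -\det A(\pm1) = 215055782117376 = D_{\pm1}(22)$. Hence $\max\{|\det\mathrm{circ}(a)| : a\in[-1,1]^n\} > D_{\pm1}(n)$ for $n\in\{9,10,22\}$.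
   Context: For a positive integer $n$, $\mathrm{circ}(a_0,\ldots,a_{n-1})$ denotes the $n\times n$ circulant matrix $(a_{(k-j)\bmod n})_{0\le j,k<n}$, whose first row is $a=(a_0,\ldots,a_{n-1})$. $D_{\pm1}(n)$ denotes the maximum of $|\det B|$ over all $n \times n$ circulant matrices $B$ with entries in $\{-1,1\}$, i.e. the maximum of $|\det\mathrm{circ}(a)|$ over the extreme points $a \in \{-1,1\}^n$ of the cube $[-1,1]^n$. *)

theory Defs
  imports
    Complex_Main
    "HOL-Library.Landau_Symbols"
    "Jordan_Normal_Form.Determinant"
begin

text \<open>The index difference \<open>k - j\<close> is taken in \<^typ>\<open>int\<close>, so that \<open>mod\<close> returns a residue
  in \<open>{0..<n}\<close> even for \<open>k < j\<close>.\<close>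

definition circ :: "'a vec \<Rightarrow> 'a mat" where
  "circ a = mat (dim_vec a) (dim_vec a)
     (\<lambda>(j, k). a $ nat ((int k - int j) mod int (dim_vec a)))"

definition circulant_mats :: "nat \<Rightarrow> 'a set \<Rightarrow> 'a mat set" where
  "circulant_mats n S = {B. (\<exists>a \<in> carrier_vec n. B = circ a) \<and> elements_mat B \<subseteq> S}"

definition D_pm1 :: "nat \<Rightarrow> real" where
  "D_pm1 n = Max ((\<lambda>B. \<bar>det B\<bar>) ` circulant_mats n {-1, 1})"

definition cube :: "nat \<Rightarrow> real vec set" where
  "cube n = {a \<in> carrier_vec n. set\<^sub>v a \<subseteq> {-1..1}}"

text \<open>Same notion as \<open>extreme_point_of\<close> in HOL-Analysis, which needs a type of class
  \<open>real_vector\<close> and so does not apply to \<^typ>\<open>real vec\<close>.\<close>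

definition extreme_points :: "real vec set \<Rightarrow> real vec set" where
  "extreme_points S = {a \<in> S. \<not> (\<exists>b \<in> S. \<exists>c \<in> S. \<exists>t. b \<noteq> c \<and> 0 < t \<and> t < 1 \<and>
     a = (1 - t) \<cdot>\<^sub>v b + t \<cdot>\<^sub>v c)}"

end

theory Submission
  imports Defs "HOL-Analysis.Function_Topology"
begin

text \<open>
  The discrete Fourier transform diagonalises circulant matrices. For odd \<open>n\<close> the determinant is therefore
  the sum of the first row times a product of squared absolute values of Fourier coefficients, and these
  depend only on the periodic autocorrelations of the row. For \<open>n = 2 h\<close> with \<open>h\<close> odd, splitting the frequencies
  by parity factors the determinant into two circulant determinants of order \<open>h\<close>; for a row of signs the two
  factors are \<open>2\<^sup>h\<close> times determinants of rows \<open>p\<close>, \<open>q\<close> in \<open>{-1, 0, 1}\<close> with complementary supports.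

  For \<open>h = 11\<close> the product of the determinants of \<open>p\<close> and \<open>q\<close> is bounded through their autocorrelations
  \<open>c\<^sub>k\<close>, \<open>d\<^sub>k\<close> (\<open>1 \<le> k \<le> 5\<close>). Complementarity of the supports forces \<open>c\<^sub>k + d\<^sub>k\<close> to be odd. AM-GM and
  Maclaurin's inequality for the five power spectrum values leave only finitely many autocorrelations, with small
  sum of squares, that could exceed the claimed maximum; of these, only two families have a partner of opposite
  parity with too large a product, and neither consists of autocorrelations of ternary sequences.

  The maximum over the cube exists by compactness, extreme points are sign vectors, and the displayed matrices
  with an entry 0 beat all sign matrices.
\<close>

section \<open>Discrete Fourier transform and circulant determinants\<close>

definition dft :: "nat \<Rightarrow> (nat \<Rightarrow> real) \<Rightarrow> nat \<Rightarrow> complex" where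
  "dft n a j = (\<Sum>k<n. of_real (a k) * cis (2 * pi * real j * real k / real n))"

lemma cis_root_mod:
  assumes "n > 0"
  shows "cis (2 * pi * real j * real (k mod n) / real n) = cis (2 * pi * real j * real k / real n)"
proof -
  have "real k = real (k mod n) + real n * real (k div n)"
    by (metis mod_mult_div_eq of_nat_add of_nat_mult)
  then have "2 * pi * real j * real k / real n
      = 2 * pi * real j * real (k mod n) / real n + 2 * pi * real (j * (k div n))"
    using assms by (simp add: field_simps)
  moreover have "cis (2 * pi * real (j * (k div n))) = 1"
    by (rule cis_multiple_2pi) (rule Ints_of_nat)
  ultimately show ?thesis
    by (simp flip: cis_mult)
qed

lemma dft_mod: "n > 0 \<Longrightarrow> dft n a (j mod n) = dft n a j"
  unfolding dft_def
  using cis_root_mod[of n _ j] by (intro sum.cong) (simp_all add: mult_ac)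

lemma sum_cis_root:
  assumes n: "n > 0" and "\<not> n dvd j"
  shows "(\<Sum>k<n. cis (2 * pi * real j * real k / real n)) = 0"
proof -
  define w where "w = cis (2 * pi * real j / real n)"
  have pow: "cis (2 * pi * real j * real k / real n) = w ^ k" for k
    by (simp add: w_def DeMoivre mult_ac)
  have "w \<noteq> 1"
  proof
    assume "w = 1"
    then obtain i :: int where "2 * pi * real j / real n = of_int i * (2 * pi)"
      unfolding w_def by (auto simp: complex_eq_iff cos_one_2pi_int)
    then have "real_of_int (int j) = real_of_int (int n * i)"
      using n by (simp add: field_simps)
    then have "int n dvd int j"
      unfolding of_int_eq_iff by simp
    then show False using assms by simp
  qed
  moreover have "w ^ n = 1"
    using n by (simp flip: pow)
  ultimately show ?thesis
    unfolding pow by (simp add: sum_gp_strict)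
qed

lemma bij_betw_circular_shift:
  assumes "n > (0::nat)"
  shows "bij_betw (\<lambda>i. (i + r) mod n) {..<n} {..<n}"
proof -
  have "i = j" if "i < n" "j < n" "(i + r) mod n = (j + r) mod n" for i j
  proof -
    have "int (i + r) mod int n = int (j + r) mod int n"
      using that(3) by (metis zmod_int)
    then have "(int (i + r) - int r) mod int n = (int (j + r) - int r) mod int n"
      by (rule mod_diff_cong) simp
    then show "i = j" using that(1,2) by simp
  qed
  then have "inj_on (\<lambda>i. (i + r) mod n) {..<n}"
    by (auto intro: inj_onI)
  moreover have "(\<lambda>i. (i + r) mod n) ` {..<n} \<subseteq> {..<n}" using assms by auto
  ultimately show ?thesis
    unfolding bij_betw_def by (simp add: endo_inj_surj)
qed

lemmas sum_circular_shift = sum.reindex_bij_betw[OF bij_betw_circular_shift]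
lemmas prod_circular_shift = prod.reindex_bij_betw[OF bij_betw_circular_shift]

lemma circ_carrier [simp]: "circ a \<in> carrier_mat (dim_vec a) (dim_vec a)"
  by (simp add: circ_def)

lemma dim_circ [simp]: "dim_row (circ a) = dim_vec a" "dim_col (circ a) = dim_vec a"
  by (simp_all add: circ_def)

text \<open>Adding \<open>n - j\<close> in place of subtracting \<open>j\<close> keeps the index in
  the natural numbers and in the form of a circular shift, so that sums over a row can be
  reindexed.\<close>

lemma circ_vec_index:
  assumes "j < n" "k < n"
  shows "circ (vec n a) $$ (j, k) = a ((k + (n - j)) mod n)"
proof -
  have "(int k - int j) mod int n = (int k - int j + int n) mod int n" by simp
  also have "int k - int j + int n = int (k + (n - j))" using assms by simp
  finally have "nat ((int k - int j) mod int n) = (k + (n - j)) mod n"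
    by (metis nat_int zmod_int)
  moreover have "(k + (n - j)) mod n < n" using assms by simp
  ultimately show ?thesis using assms by (simp add: circ_def)
qed

text \<open>The columns of the Fourier matrix \<open>F\<close> are eigenvectors,
  \<open>A * F = F * D\<close>. Its conjugate transpose \<open>G\<close> satisfies that
  \<open>F * G\<close> is \<open>n\<close> times the identity, so \<open>det F\<close> is nonzero
  and cancels.\<close>

theorem det_circ_dft:
  assumes n: "n > 0"
  shows "of_real (det (circ (vec n a))) = (\<Prod>j<n. dft n a j)"
proof -
  let ?e = "\<lambda>j k. cis (2 * pi * real j * real k / real n)"
  define A :: "complex mat" where "A = map_mat of_real (circ (vec n a))"
  define F where "F = mat n n (\<lambda>(j, m). ?e m j)"
  define G where "G = mat n n (\<lambda>(m, j). cnj (?e m j))"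
  define D where "D = mat n n (\<lambda>(j, m). if j = m then dft n a m else 0)"
  have car [simp]: "A \<in> carrier_mat n n" "F \<in> carrier_mat n n" "G \<in> carrier_mat n n"
    "D \<in> carrier_mat n n"
    by (auto simp: A_def F_def G_def D_def circ_def)
  have AF: "A * F = F * D"
  proof (rule eq_matI)
    fix j m assume "j < dim_row (F * D)" "m < dim_col (F * D)"
    then have jm: "j < n" "m < n" by (auto simp: F_def D_def)
    have "(A * F) $$ (j, m) = (\<Sum>k<n. of_real (a ((k + (n - j)) mod n)) * ?e m k)"
      using jm car by (simp add: scalar_prod_def F_def A_def circ_vec_index
          lessThan_atLeast0 )
    \<comment> \<open>The character at \<open>k\<close> is its value at the shifted index times its
      value at \<open>j\<close>; the latter factor leaves the sum and the rest is a circular shift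
      of the transform.\<close>
    also have "\<dots> = (\<Sum>k<n. of_real (a ((k + (n - j)) mod n)) * ?e m ((k + (n - j)) mod n) * ?e m j)"
    proof (rule sum.cong[OF refl])
      fix k assume "k \<in> {..<n}"
      have "?e m ((k + (n - j)) mod n) * ?e m j = ?e m (k + (n - j)) * ?e m j"
        using cis_root_mod[OF n] by simp
      also have "\<dots> = ?e m (k + n)"
        using jm by (simp add: cis_mult field_simps of_nat_diff)
      also have "\<dots> = ?e m k"
        using cis_root_mod[OF n, of m "k + n"] cis_root_mod[OF n, of m k] by simp
      finally show "of_real (a ((k + (n - j)) mod n)) * ?e m k =
          of_real (a ((k + (n - j)) mod n)) * ?e m ((k + (n - j)) mod n) * ?e m j"
        by (simp add: mult.assoc)
    qed
    also have "\<dots> = dft n a m * ?e m j"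
      unfolding dft_def sum_distrib_right
      by (rule sum_circular_shift[OF n, where g = "\<lambda>i. of_real (a i) * ?e m i * ?e m j"])
    also have "\<dots> = (\<Sum>i<n. if i = m then dft n a m * ?e i j else 0)"
      using jm by simp
    also have "\<dots> = (F * D) $$ (j, m)"
      using jm by (simp add: scalar_prod_def F_def D_def lessThan_atLeast0 mult_ac
          if_distrib[of "\<lambda>x. x * c" for c] cong: if_cong)
    finally show "(A * F) $$ (j, m) = (F * D) $$ (j, m)" .
  qed (auto simp: A_def F_def D_def circ_def)
  have FG: "F * G = of_nat n \<cdot>\<^sub>m 1\<^sub>m n"
  proof (rule eq_matI)
    fix j k assume "j < dim_row (of_nat n \<cdot>\<^sub>m 1\<^sub>m n :: complex mat)"
      "k < dim_col (of_nat n \<cdot>\<^sub>m 1\<^sub>m n :: complex mat)"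
    then have jk: "j < n" "k < n" by auto
    have "(F * G) $$ (j, k) = (\<Sum>m<n. ?e m j * cnj (?e m k))"
      using jk by (simp add: scalar_prod_def F_def G_def lessThan_atLeast0)
    also have "\<dots> = (\<Sum>m<n. ?e (j + (n - k)) m)"
    proof (rule sum.cong[OF refl])
      fix m assume "m \<in> {..<n}"
      have "?e m j * cnj (?e m k) = ?e m (j + n) * cnj (?e m k)"
        using cis_root_mod[OF n, of m j] cis_root_mod[OF n, of m "j + n"] by simp
      also have "\<dots> = cis (2 * pi * real m * real (j + n) / real n - 2 * pi * real m * real k / real n)"
        by (simp add: cis_cnj cis_mult)
      also have "2 * pi * real m * real (j + n) / real n - 2 * pi * real m * real k / real n
          = 2 * pi * real (j + (n - k)) * real m / real n"
        using jk by (simp add: of_nat_diff algebra_simps flip: diff_divide_distrib)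
      finally show "?e m j * cnj (?e m k) = ?e (j + (n - k)) m" .
    qed
    also have "\<dots> = (if j = k then of_nat n else 0)"
    proof (cases "j = k")
      case True
      have "?e n m = 1" for m
        using n cis_multiple_2pi[of "real m"] by (simp add: mult_ac)
      then show ?thesis using True jk by simp
    next
      case False
      have "\<not> n dvd j + (n - k)"
      proof
        assume "n dvd j + (n - k)"
        then obtain q where q: "j + (n - k) = n * q" by auto
        \<comment> \<open>\<open>j + (n - k)\<close> lies strictly between 0 and
          \<open>2 * n\<close>, so the only multiple of \<open>n\<close> it can equal is
          \<open>n\<close> itself, which means \<open>j = k\<close>.\<close>
        have "n * q < n * 2" "0 < n * q" using q jk by linarith+
        then have "q = 1" by simp
        then show False using q jk False by simp
      qed
      then show ?thesis using False by (simp only: sum_cis_root[OF n] if_False not_False_eq_True)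
    qed
    finally show "(F * G) $$ (j, k) = (of_nat n \<cdot>\<^sub>m 1\<^sub>m n) $$ (j, k)"
      using jk by simp
  qed (auto simp: F_def G_def)
  have "det F * det G = det (F * G)"
    by (rule det_mult[OF car(2,3), symmetric])
  also have "\<dots> = of_nat n ^ n"
    unfolding FG by (simp add: det_smult)
  finally have "det F \<noteq> 0" using n by auto
  moreover have "det A * det F = det F * det D"
    using det_mult[OF car(1,2)] det_mult[OF car(2,4)] AF by metis
  ultimately have "det A = det D" by (metis mult.commute mult_cancel_left)
  moreover have "det D = (\<Prod>j<n. dft n a j)"
    by (subst det_upper_triangular[of _ n])
      (auto simp: D_def diag_mat_def prod.list_conv_set_nth lessThan_atLeast0 intro!: prod.cong)
  moreover have "det A = of_real (det (circ (vec n a)))"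
    unfolding A_def by (rule of_real_hom.hom_det)
  ultimately show ?thesis by simp
qed

lemma dft_reflect:
  assumes "n > 0" "j \<le> n"
  shows "dft n a (n - j) = cnj (dft n a j)"
proof -
  have "cis (2 * pi * real (n - j) * real k / real n) = cnj (cis (2 * pi * real j * real k / real n))" for k
  proof -
    have "2 * pi * real (n - j) * real k / real n = 2 * pi * real k - 2 * pi * real j * real k / real n"
      using assms by (simp add: of_nat_diff field_simps)
    then have "cis (2 * pi * real (n - j) * real k / real n)
        = cis (2 * pi * real k) * cis (- (2 * pi * real j * real k / real n))"
      by (simp only: cis_mult diff_conv_add_uminus)
    moreover have "cis (2 * pi * real k) = 1"
      by (rule cis_multiple_2pi) (rule Ints_of_nat)
    ultimately show ?thesis by (simp add: cis_cnj)
  qed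
  then show ?thesis by (simp add: dft_def)
qed

section \<open>Periodic autocorrelation and power spectrum\<close>

definition acorr :: "nat \<Rightarrow> (nat \<Rightarrow> 'a::comm_semiring_1) \<Rightarrow> nat \<Rightarrow> 'a" where
  "acorr n a k = (\<Sum>i<n. a i * a ((i + k) mod n))"

lemma acorr_0: "acorr n a 0 = (\<Sum>i<n. (a i)\<^sup>2)"
  by (simp add: acorr_def power2_eq_square)

lemma acorr_reflect:
  assumes "n > 0" "k \<le> n"
  shows "acorr n a (n - k) = acorr n a k"
proof -
  have "acorr n a k = (\<Sum>i<n. a i * a ((i + k) mod n))" by (simp add: acorr_def)
  also have "\<dots> = (\<Sum>i<n. a ((i + (n - k)) mod n) * a (((i + (n - k)) mod n + k) mod n))"
    by (rule sum_circular_shift[OF assms(1), symmetric])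
  also have "\<dots> = (\<Sum>i<n. a i * a ((i + (n - k)) mod n))"
    using assms by (intro sum.cong) (simp_all add: mod_add_left_eq mult.commute)
  finally show ?thesis by (simp add: acorr_def)
qed

text \<open>Wiener-Khinchin: after expanding the square, a shift of the inner index by
  \<open>i\<close> collects the terms of lag \<open>k\<close>. Taking real parts turns characters
  into cosines.\<close>

lemma norm_dft_sq:
  assumes n: "n > 0"
  shows "(cmod (dft n a j))\<^sup>2 = (\<Sum>k<n. acorr n a k * cos (2 * pi * real j * real k / real n))"
proof -
  let ?e = "\<lambda>k. cis (2 * pi * real j * real k / real n)"
  have "of_real ((cmod (dft n a j))\<^sup>2) = cnj (dft n a j) * dft n a j"
    by (subst mult.commute) (rule complex_norm_square)
  also have "\<dots> = (\<Sum>i<n. \<Sum>k<n. of_real (a i) * cnj (?e i) * (of_real (a k) * ?e k))"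
    by (simp add: dft_def sum_product)
  also have "\<dots> = (\<Sum>i<n. \<Sum>k<n. of_real (a i) * cnj (?e i) * (of_real (a ((k + i) mod n)) * ?e ((k + i) mod n)))"
    by (intro sum.cong refl sum_circular_shift[OF n, symmetric])
  also have "\<dots> = (\<Sum>i<n. \<Sum>k<n. of_real (a i * a ((i + k) mod n)) * ?e k)"
  proof (intro sum.cong refl)
    fix i k
    have "cnj (?e i) * ?e ((k + i) mod n) = cnj (?e i) * ?e (k + i)"
      using cis_root_mod[OF n] by simp
    also have "\<dots> = ?e k"
      using n by (simp add: cis_cnj cis_mult distrib_left add_divide_distrib)
    finally show "of_real (a i) * cnj (?e i) * (of_real (a ((k + i) mod n)) * ?e ((k + i) mod n))
        = of_real (a i * a ((i + k) mod n)) * ?e k"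
      by (simp add: mult_ac add.commute)
  qed
  also have "\<dots> = (\<Sum>k<n. of_real (acorr n a k) * ?e k)"
    by (subst sum.swap) (simp add: acorr_def sum_distrib_right)
  finally have "complex_of_real ((cmod (dft n a j))\<^sup>2) = (\<Sum>k<n. of_real (acorr n a k) * ?e k)" .
  then have "Re (complex_of_real ((cmod (dft n a j))\<^sup>2)) = Re (\<Sum>k<n. of_real (acorr n a k) * ?e k)"
    by (rule arg_cong)
  then show ?thesis by simp
qed

text \<open>The squared absolute value of the transform for odd \<open>n\<close>, with the lags
  \<open>k\<close> and \<open>n - k\<close> merged (\<open>norm_dft_sq_odd\<close>). For positive
  even \<open>n\<close> the lag \<open>n div 2\<close> would be counted twice.\<close>

definition psd :: "nat \<Rightarrow> (nat \<Rightarrow> real) \<Rightarrow> nat \<Rightarrow> real" where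
  "psd n a j = acorr n a 0
     + (\<Sum>k = 1..n div 2. acorr n a k * (2 * cos (2 * pi * real j * real k / real n)))"

lemma cos_root_reflect:
  assumes "n > 0" "k \<le> n"
  shows "cos (2 * pi * real j * real (n - k) / real n) = cos (2 * pi * real j * real k / real n)"
proof -
  have "2 * pi * real j * real (n - k) / real n = 2 * pi * real j - 2 * pi * real j * real k / real n"
    using assms by (simp add: of_nat_diff field_simps)
  then have "cos (2 * pi * real j * real (n - k) / real n)
      = Re (cis (2 * pi * real j) * cis (- (2 * pi * real j * real k / real n)))"
    by (simp only: cis_mult) simp
  moreover have "cis (2 * pi * real j) = 1"
    by (rule cis_multiple_2pi) (rule Ints_of_nat)
  ultimately show ?thesis by simp
qed

lemma lessThan_odd_split:
  "{..<2 * m + 1 :: nat} = insert 0 ({1..m} \<union> (\<lambda>k. 2 * m + 1 - k) ` {1..m})" (is "?A = ?B")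
proof -
  have "x \<in> (\<lambda>k. 2 * m + 1 - k) ` {1..m}" if "x < 2 * m + 1" "x > m" for x
    using that by (intro image_eqI[of _ _ "2 * m + 1 - x"]) auto
  then show ?thesis by (auto simp: not_le) (metis not_le Suc_leI)
qed

lemma sum_odd_split:
  "(\<Sum>k<2 * m + 1. g k) = g 0 + (\<Sum>k = 1..m. g k + g (2 * m + 1 - k))"
  for g :: "nat \<Rightarrow> 'a::comm_monoid_add"
proof -
  have "(\<Sum>k<2 * m + 1. g k) = g 0 + ((\<Sum>k = 1..m. g k) + (\<Sum>k\<in>(\<lambda>k. 2 * m + 1 - k) ` {1..m}. g k))"
    unfolding lessThan_odd_split
    by (subst sum.insert) (auto intro!: sum.union_disjoint arg_cong2[of _ _ _ _ "(+)"])
  also have "(\<Sum>k\<in>(\<lambda>k. 2 * m + 1 - k) ` {1..m}. g k) = (\<Sum>k = 1..m. g (2 * m + 1 - k))"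
    by (subst sum.reindex) (auto simp: inj_on_def)
  finally show ?thesis by (simp add: sum.distrib)
qed

lemma prod_odd_split:
  "(\<Prod>k<2 * m + 1. g k) = g 0 * (\<Prod>k = 1..m. g k * g (2 * m + 1 - k))"
  for g :: "nat \<Rightarrow> 'a::comm_monoid_mult"
proof -
  have "(\<Prod>k<2 * m + 1. g k) = g 0 * ((\<Prod>k = 1..m. g k) * (\<Prod>k\<in>(\<lambda>k. 2 * m + 1 - k) ` {1..m}. g k))"
    unfolding lessThan_odd_split
    by (subst prod.insert) (auto intro!: prod.union_disjoint arg_cong2[of _ _ _ _ "(*)"])
  also have "(\<Prod>k\<in>(\<lambda>k. 2 * m + 1 - k) ` {1..m}. g k) = (\<Prod>k = 1..m. g (2 * m + 1 - k))"
    by (subst prod.reindex) (auto simp: inj_on_def)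
  finally show ?thesis by (simp add: prod.distrib)
qed

lemma norm_dft_sq_odd:
  assumes n: "n = 2 * m + 1"
  shows "(cmod (dft n a j))\<^sup>2 = psd n a j"
proof -
  define g where "g k = acorr n a k * cos (2 * pi * real j * real k / real n)" for k
  have "g k + g (n - k) = acorr n a k * (2 * cos (2 * pi * real j * real k / real n))" if "k \<in> {1..m}" for k
    using that n cos_root_reflect[of n k j] acorr_reflect[of n k a] by (simp add: g_def)
  moreover have "sum g {..<n} = g 0 + (\<Sum>k = 1..m. g k + g (n - k))"
    unfolding n by (rule sum_odd_split)
  moreover have "n > 0" "n div 2 = m" using n by auto
  ultimately show ?thesis
    by (simp add: norm_dft_sq[OF \<open>n > 0\<close>] psd_def g_def mult_ac)
qed

lemma psd_nonneg: "n = 2 * m + 1 \<Longrightarrow> psd n a j \<ge> 0"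
  by (metis norm_dft_sq_odd zero_le_power2)

lemma dft_0: "dft n a 0 = of_real (\<Sum>k<n. a k)"
  by (simp add: dft_def)

lemma psd_0:
  assumes "n = 2 * m + 1"
  shows "psd n a 0 = (\<Sum>k<n. a k)\<^sup>2"
  unfolding norm_dft_sq_odd[OF assms, symmetric] dft_0 by (simp only: norm_of_real power2_abs)

text \<open>The row is real, so the frequencies \<open>j\<close> and \<open>n - j\<close> contribute
  conjugate factors, whose product is a power spectrum value. Frequency 0 contributes the sum of the
  row.\<close>

theorem det_circ_odd:
  assumes n: "n = 2 * m + 1"
  shows "det (circ (vec n a)) = (\<Sum>k<n. a k) * (\<Prod>j = 1..m. psd n a j)"
proof -
  have pos: "n > 0" using n by simp
  have "complex_of_real (det (circ (vec n a))) = (\<Prod>j<2 * m + 1. dft n a j)"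
    using det_circ_dft[OF pos] n by simp
  also have "\<dots> = dft n a 0 * (\<Prod>j = 1..m. dft n a j * dft n a (n - j))"
    unfolding prod_odd_split n ..
  also have "(\<Prod>j = 1..m. dft n a j * dft n a (n - j)) = (\<Prod>j = 1..m. of_real (psd n a j))"
  proof (intro prod.cong refl)
    fix j assume "j \<in> {1..m}"
    then have "dft n a j * dft n a (n - j) = dft n a j * cnj (dft n a j)"
      using n by (subst dft_reflect) auto
    also have "\<dots> = of_real (psd n a j)"
      by (simp only: norm_dft_sq_odd[OF n, symmetric] complex_norm_square)
    finally show "dft n a j * dft n a (n - j) = of_real (psd n a j)" .
  qed
  also have "dft n a 0 = of_real (\<Sum>k<n. a k)" by (rule dft_0)
  finally show ?thesis by (simp only: of_real_eq_iff flip: of_real_prod of_real_mult)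
qed

section \<open>Factoring a determinant of order twice an odd number\<close>

lemma prod_lessThan_double:
  "(\<Prod>j<2 * h. g j) = (\<Prod>j<h. g (2 * j)) * (\<Prod>j<h. g (2 * j + 1))"
  for g :: "nat \<Rightarrow> 'a::comm_monoid_mult"
  by (induction h) (simp_all add: mult_ac)

lemma sum_lessThan_double: "(\<Sum>k<2 * h. g k) = (\<Sum>k<h. g k + g (k + h))"
  for g :: "nat \<Rightarrow> 'a::comm_monoid_add"
proof -
  have "(\<Sum>k<2 * h. g k) = (\<Sum>k<h. g k) + (\<Sum>k<h. g (k + h))"
    using sum.atLeastLessThan_concat[of 0 h "2 * h" g] sum.shift_bounds_nat_ivl[of g 0 h h]
    by (simp add: atLeast0LessThan mult_2)
  then show ?thesis by (simp add: sum.distrib)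
qed

text \<open>Even frequencies \<open>2 * j\<close> see only \<open>a i + a (i + h)\<close>. As
  \<open>h\<close> is odd, the odd frequencies modulo \<open>2 * h\<close> are the
  \<open>2 * j + h\<close>; there the character at \<open>k\<close> carries the extra sign
  \<open>(-1) ^ k\<close>, which flips at \<open>k + h\<close>, hence the alternating
  difference.\<close>

theorem det_circ_double_odd:
  fixes a :: "nat \<Rightarrow> real"
  assumes h: "odd h"
  shows "det (circ (vec (2 * h) a)) =
    det (circ (vec h (\<lambda>i. a i + a (i + h)))) * det (circ (vec h (\<lambda>i. (-1) ^ i * (a i - a (i + h)))))"
proof -
  let ?P = "\<lambda>i. a i + a (i + h)" and ?Q = "\<lambda>i. (-1) ^ i * (a i - a (i + h))"
  have pos: "h > 0" using h by (cases h) auto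
  obtain r where r: "h = 2 * r + 1" using h by (elim oddE)
  have per: "cis (2 * pi * real j * real (k + h) / real h) = cis (2 * pi * real j * real k / real h)" for j k
    using cis_root_mod[OF pos, of j "k + h"] cis_root_mod[OF pos, of j k] by simp
  have P: "dft (2 * h) a (2 * j) = dft h ?P j" for j
  proof -
    have e: "cis (2 * pi * real (2 * j) * real k / real (2 * h)) = cis (2 * pi * real j * real k / real h)" for k
      by (simp add: mult_ac)
    show ?thesis
      unfolding dft_def sum_lessThan_double e per by (simp add: distrib_right)
  qed
  have Q: "dft (2 * h) a (2 * j + h) = dft h ?Q j" for j
  proof -
    have e1: "cis (2 * pi * real (2 * j + h) * real k / real (2 * h)) =
        (-1) ^ k * cis (2 * pi * real j * real k / real h)" for k
    proof -
      have "2 * pi * real (2 * j + h) * real k / real (2 * h) = 2 * pi * real j * real k / real h + real k * pi"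
        using pos by (simp add: field_simps)
      then show ?thesis by (simp add: cis_mult[symmetric] DeMoivre[symmetric])
    qed
    have "cis (2 * pi * real (2 * j + h) * real (k + h) / real (2 * h)) =
        - ((-1) ^ k * cis (2 * pi * real j * real k / real h))" for k
      unfolding e1 per using h by (simp add: power_add)
    with e1 show ?thesis
      unfolding dft_def sum_lessThan_double by (intro sum.cong) (simp_all add: algebra_simps)
  qed
  \<comment> \<open>With \<open>h = 2 * r + 1\<close>, shifting \<open>j\<close> by \<open>r\<close>
    turns the frequency \<open>2 * j + 1\<close> into \<open>2 * j + h\<close> modulo
    \<open>2 * h\<close>.\<close>
  have "(\<Prod>j<h. dft (2 * h) a (2 * j + 1)) = (\<Prod>j<h. dft (2 * h) a (2 * ((j + r) mod h) + 1))"
    by (rule prod_circular_shift[OF pos, symmetric])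
  also have "\<dots> = (\<Prod>j<h. dft h ?Q j)"
  proof (rule prod.cong[OF refl])
    fix j
    have "dft (2 * h) a (2 * ((j + r) mod h) + 1) = dft (2 * h) a ((2 * ((j + r) mod h) + 1) mod (2 * h))"
      using pos by (simp add: dft_mod)
    also have "(2 * ((j + r) mod h) + 1) mod (2 * h) = (2 * j + h) mod (2 * h)"
      unfolding mult_mod_right by (simp add: mod_add_left_eq mod_Suc_eq r)
    also have "dft (2 * h) a \<dots> = dft h ?Q j" using pos Q by (simp add: dft_mod)
    finally show "dft (2 * h) a (2 * ((j + r) mod h) + 1) = dft h ?Q j" .
  qed
  finally have "complex_of_real (det (circ (vec (2 * h) a))) =
      (\<Prod>j<h. dft h ?P j) * (\<Prod>j<h. dft h ?Q j)"
    using pos by (simp add: det_circ_dft prod_lessThan_double P)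
  also have "\<dots> = of_real (det (circ (vec h ?P)) * det (circ (vec h ?Q)))"
    using pos by (simp add: det_circ_dft)
  finally show ?thesis by (simp only: of_real_eq_iff)
qed

section \<open>Circulant matrices over signs and over the cube\<close>

lemma vec_of_list_eq_vec: "vec_of_list xs = vec (length xs) ((!) xs)"
  by (rule eq_vecI) (simp_all add: vec_of_list_index)

lemma circulant_mats_eq:
  assumes n: "n > 0"
  shows "circulant_mats n S = (\<lambda>a. circ (vec n a)) ` {a. \<forall>i<n. a i \<in> S}"
proof (intro equalityI subsetI)
  fix B assume "B \<in> circulant_mats n S"
  then obtain v where v: "v \<in> carrier_vec n" "B = circ v" "elements_mat B \<subseteq> S"
    by (auto simp: circulant_mats_def)
  define a where "a i = v $ i" for i
  have va: "v = vec n a" using v(1) by (intro eq_vecI) (auto simp: a_def)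
  have "a i \<in> S" if "i < n" for i
  proof -
    have "B $$ (0, i) = a i" unfolding v(2) va using that n by (simp add: circ_vec_index)
    moreover have "B $$ (0, i) \<in> elements_mat B"
      using that n v(1,2) by (intro elements_matI[of B n n 0 i]) auto
    ultimately show ?thesis using v(3) by auto
  qed
  then show "B \<in> (\<lambda>a. circ (vec n a)) ` {a. \<forall>i<n. a i \<in> S}" using v(2) va by auto
next
  fix B assume "B \<in> (\<lambda>a. circ (vec n a)) ` {a. \<forall>i<n. a i \<in> S}"
  then obtain a where a: "B = circ (vec n a)" "\<forall>i<n. a i \<in> S" by auto
  have "elements_mat B \<subseteq> S"
  proof
    fix x assume "x \<in> elements_mat B"
    then obtain j k where "j < n" "k < n" "x = B $$ (j, k)"
      using a(1) by (auto dest!: elements_matD)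
    then show "x \<in> S" using a n by (simp add: circ_vec_index)
  qed
  then show "B \<in> circulant_mats n S" using a(1) by (auto simp: circulant_mats_def)
qed

lemma finite_circulant_mats:
  assumes "n > 0" "finite S"
  shows "finite (circulant_mats n S)"
proof -
  have "circulant_mats n S \<subseteq> (\<lambda>a. circ (vec n a)) ` (PiE {..<n} (\<lambda>_. S))"
  proof
    fix B assume "B \<in> circulant_mats n S"
    then obtain a where a: "B = circ (vec n a)" "\<forall>i<n. a i \<in> S"
      unfolding circulant_mats_eq[OF assms(1)] by blast
    have "vec n (restrict a {..<n}) = vec n a" by (intro eq_vecI) simp_all
    then have "B = circ (vec n (restrict a {..<n}))" using a(1) by simp
    moreover have "restrict a {..<n} \<in> PiE {..<n} (\<lambda>_. S)" using a(2) by (simp add: PiE_iff)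
    ultimately show "B \<in> (\<lambda>a. circ (vec n a)) ` (PiE {..<n} (\<lambda>_. S))" by (rule image_eqI)
  qed
  moreover have "finite (PiE {..<n} (\<lambda>_. S))" using assms by (intro finite_PiE) auto
  ultimately show ?thesis by (meson finite_imageI finite_subset)
qed

lemma det_circ_le_D_pm1:
  assumes n: "n > 0" and a: "\<And>i. i < n \<Longrightarrow> a i \<in> {-1, 1}"
  shows "\<bar>det (circ (vec n a))\<bar> \<le> D_pm1 n"
  unfolding D_pm1_def
proof (rule Max_ge)
  show "finite ((\<lambda>B::real mat. \<bar>det B\<bar>) ` circulant_mats n {-1, 1})"
    using finite_circulant_mats[OF n, of "{-1, 1::real}"] by simp
  show "\<bar>det (circ (vec n a))\<bar> \<in> (\<lambda>B. \<bar>det B\<bar>) ` circulant_mats n {-1, 1}"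
    using a by (auto simp: circulant_mats_eq[OF n])
qed

text \<open>The upper bound is asked for integer rows only, where it can be checked by exact
  computation. A real sign equals its floor, which carries the bound over to real rows.\<close>

lemma D_pm1_eqI:
  assumes n: "n > 0"
    and ub: "\<And>b. (\<And>i. i < n \<Longrightarrow> b i \<in> {-1, 1 :: int}) \<Longrightarrow> \<bar>det (circ (vec n (\<lambda>i. real_of_int (b i))))\<bar> \<le> M"
    and a: "\<And>i. i < n \<Longrightarrow> a i \<in> {-1, 1 :: real}" "\<bar>det (circ (vec n a))\<bar> = M"
  shows "D_pm1 n = M"
proof (rule antisym)
  show "M \<le> D_pm1 n" using det_circ_le_D_pm1[OF n, of a] a by auto
  show "D_pm1 n \<le> M"
    unfolding D_pm1_def
  proof (rule Max.boundedI)
    show "finite ((\<lambda>B::real mat. \<bar>det B\<bar>) ` circulant_mats n {-1, 1})"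
      using finite_circulant_mats[OF n, of "{-1, 1::real}"] by simp
    show "(\<lambda>B. \<bar>det B\<bar>) ` circulant_mats n {-1, 1 :: real} \<noteq> {}"
      using a(1) by (auto simp: circulant_mats_eq[OF n])
  next
    fix y assume "y \<in> (\<lambda>B::real mat. \<bar>det B\<bar>) ` circulant_mats n {-1, 1}"
    then obtain c where c: "y = \<bar>det (circ (vec n c))\<bar>" "\<forall>i<n. c i \<in> {-1, 1 :: real}"
      unfolding circulant_mats_eq[OF n] image_image by (elim imageE) simp
    have *: "real_of_int \<lfloor>c i\<rfloor> = c i \<and> \<lfloor>c i\<rfloor> \<in> {-1, 1}" if i: "i < n" for i
    proof -
      consider "c i = -1" | "c i = 1" using c(2) i by auto
      then show ?thesis by cases (simp_all add: floor_eq_iff)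
    qed
    have "\<bar>det (circ (vec n (\<lambda>i. real_of_int \<lfloor>c i\<rfloor>)))\<bar> \<le> M"
      by (rule ub) (rule *[THEN conjunct2])
    also have "vec n (\<lambda>i. real_of_int \<lfloor>c i\<rfloor>) = vec n c"
      by (rule eq_vecI) (simp_all add: *)
    finally show "y \<le> M" by (simp only: c(1))
  qed
qed

section \<open>The cube, its extreme points and the maximum over it\<close>

lemma mem_cube_iff: "v \<in> cube n \<longleftrightarrow> v \<in> carrier_vec n \<and> (\<forall>j<n. v $ j \<in> {-1..1})"
proof (cases "v \<in> carrier_vec n")
  case True
  then have "set\<^sub>v v = ($) v ` {..<n}" by (simp add: vec_set_def)
  then show ?thesis using True by (simp only: cube_def mem_Collect_eq image_subset_iff) blast
qed (simp add: cube_def)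

text \<open>A coordinate of absolute value below 1 can be moved by \<open>d\<close> both ways inside
  the cube, so \<open>v\<close> is the midpoint of two distinct points of the cube.\<close>

lemma extreme_points_cube:
  assumes "v \<in> extreme_points (cube n)" "i < n"
  shows "v $ i \<in> {-1, 1}"
proof (rule ccontr)
  assume ne: "v $ i \<notin> {-1, 1}"
  have v: "v \<in> carrier_vec n" "\<And>j. j < n \<Longrightarrow> v $ j \<in> {-1..1}"
    using assms(1) unfolding extreme_points_def mem_cube_iff by blast+
  define d where "d = 1 - \<bar>v $ i\<bar>"
  define w where "w s = vec n (\<lambda>j. if j = i then v $ i + s * d else v $ j)" for s :: real
  have d: "d > 0" using ne v(2)[OF assms(2)] by (auto simp: d_def abs_if)
  have "w s \<in> cube n" if "s \<in> {-1, 1}" for s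
  proof -
    have "v $ i + s * d \<in> {-1..1}"
      using that v(2)[OF assms(2)] by (auto simp: d_def abs_if)
    then show ?thesis
      using v(2) by (simp add: mem_cube_iff w_def)
  qed
  then have "w (-1) \<in> cube n" "w 1 \<in> cube n" by auto
  moreover have "w (-1) \<noteq> w 1"
  proof
    assume "w (-1) = w 1"
    then have "w (-1) $ i = w 1 $ i" by simp
    then show False using assms(2) d by (simp add: w_def)
  qed
  moreover have "v = (1 - 1/2) \<cdot>\<^sub>v w (-1) + (1/2) \<cdot>\<^sub>v w 1"
    using v(1) by (intro eq_vecI) (auto simp: w_def field_simps)
  ultimately have "\<exists>b\<in>cube n. \<exists>c\<in>cube n. \<exists>t. b \<noteq> c \<and> 0 < t \<and> t < 1 \<and> v = (1 - t) \<cdot>\<^sub>v b + t \<cdot>\<^sub>v c"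
    by (intro bexI[of _ "w (-1)"] bexI[of _ "w 1"] exI[of _ "1/2"]) simp_all
  then show False
    using assms(1) unfolding extreme_points_def by blast
qed

lemma permutes_less: "p permutes {0..<n} \<Longrightarrow> i < n \<Longrightarrow> p i < (n::nat)"
  using permutes_in_image[of p "{0..<n}" i] by simp

text \<open>By the Leibniz formula the determinant is a polynomial in finitely many coordinates,
  hence continuous in the product topology.\<close>

lemma continuous_on_det_circ: "continuous_on UNIV (\<lambda>a :: nat \<Rightarrow> real. det (circ (vec n a)))"
proof -
  have "det (circ (vec n a)) = (\<Sum>p\<in>{p. p permutes {0..<n}}. signof p * (\<Prod>i = 0..<n. a ((p i + (n - i)) mod n)))"
    for a :: "nat \<Rightarrow> real"
  proof -
    have "circ (vec n a) \<in> carrier_mat n n" by (simp add: circ_def)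
    then show ?thesis
      by (subst det_def') (auto intro!: sum.cong prod.cong simp: circ_vec_index permutes_less)
  qed
  moreover have "continuous_on UNIV (\<lambda>a. \<Sum>p\<in>{p. p permutes {0..<n}}.
      signof p * (\<Prod>i = 0..<n. (a :: nat \<Rightarrow> real) ((p i + (n - i)) mod n)))"
    by (intro continuous_on_sum continuous_on_mult continuous_on_const continuous_on_prod
        continuous_on_product_coordinates)
  ultimately show ?thesis by presburger
qed

text \<open>The product of copies of \<open>{-1..1}\<close> over all natural numbers is compact by
  Tychonoff, and its points, cut off to \<open>n\<close> coordinates, are exactly the points of the
  cube.\<close>

lemma cube_attains_max:
  "\<exists>M \<in> (\<lambda>a. \<bar>det (circ a)\<bar>) ` cube n. \<forall>y \<in> (\<lambda>a. \<bar>det (circ a)\<bar>) ` cube n. y \<le> M"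
proof -
  let ?g = "\<lambda>a :: nat \<Rightarrow> real. \<bar>det (circ (vec n a))\<bar>"
  let ?K = "PiE UNIV (\<lambda>_ :: nat. {-1..1 :: real})"
  have "compact ?K"
    using compactin_PiE[of "\<lambda>_ :: nat. euclidean :: real topology" UNIV "\<lambda>_. {-1..1}"]
    by (simp add: euclidean_product_topology compactin_euclidean_iff)
  moreover have "?K \<noteq> {}" by (simp add: PiE_eq_empty_iff)
  moreover have "continuous_on ?K ?g"
    by (intro continuous_on_rabs continuous_on_subset[OF continuous_on_det_circ]) simp
  ultimately obtain a where a: "a \<in> ?K" "\<forall>b\<in>?K. ?g b \<le> ?g a"
    using continuous_attains_sup[of ?K ?g] by blast
  show ?thesis
  proof (intro bexI ballI)
    show "?g a \<in> (\<lambda>a. \<bar>det (circ a)\<bar>) ` cube n"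
      using a(1) by (intro imageI) (simp add: mem_cube_iff PiE_iff)
  next
    fix y assume "y \<in> (\<lambda>a. \<bar>det (circ a)\<bar>) ` cube n"
    then obtain v where y: "y = \<bar>det (circ v)\<bar>" and v: "v \<in> cube n" by (elim imageE)
    define b where "b i = (if i < n then v $ i else 0)" for i
    have "v = vec n b" using v by (intro eq_vecI) (simp_all add: b_def mem_cube_iff)
    moreover have "b \<in> ?K" using v by (simp add: b_def mem_cube_iff PiE_iff)
    ultimately show "y \<le> ?g a" using a(2) unfolding y by blast
  qed
qed

text \<open>One row of the cube beating \<open>D_pm1 n\<close> suffices: the maximum is at least its
  value, while extreme points are sign vectors and stay below \<open>D_pm1 n\<close>.\<close>

lemma max_cube_gt_D_pm1:
  assumes n: "n > 0" and w: "length xs = n" "set xs \<subseteq> {-1..1}" "\<bar>det (circ (vec_of_list xs))\<bar> > D_pm1 n"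
  shows "\<exists>M \<in> (\<lambda>a. \<bar>det (circ a)\<bar>) ` cube n.
        (\<forall>y \<in> (\<lambda>a. \<bar>det (circ a)\<bar>) ` cube n. y \<le> M) \<and>
        M > D_pm1 n \<and>
        (\<forall>a \<in> extreme_points (cube n). \<bar>det (circ a)\<bar> \<noteq> M)"
proof -
  obtain M where M: "M \<in> (\<lambda>a. \<bar>det (circ a)\<bar>) ` cube n"
    "\<forall>y \<in> (\<lambda>a. \<bar>det (circ a)\<bar>) ` cube n. y \<le> M"
    using cube_attains_max by blast
  have "xs ! j \<in> {-1..1}" if "j < n" for j using w(1,2) nth_mem[of j xs] that by blast
  then have "vec_of_list xs \<in> cube n"
    using w(1) by (simp add: mem_cube_iff carrier_dim_vec vec_of_list_index)
  then have "\<bar>det (circ (vec_of_list xs))\<bar> \<le> M" using M(2) by (intro M(2)[rule_format] imageI)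
  with w(3) have gt: "M > D_pm1 n" by linarith
  have "\<bar>det (circ v)\<bar> \<noteq> M" if v: "v \<in> extreme_points (cube n)" for v
  proof -
    have "v \<in> carrier_vec n" using v by (simp add: extreme_points_def mem_cube_iff)
    then have "vec n (\<lambda>i. v $ i) = v" by (intro eq_vecI) auto
    moreover have "\<bar>det (circ (vec n (\<lambda>i. v $ i)))\<bar> \<le> D_pm1 n"
      by (intro det_circ_le_D_pm1 n extreme_points_cube[OF v])
    ultimately show ?thesis using gt by simp
  qed
  then show ?thesis using M gt by blast
qed

section \<open>Autocorrelations of integer sequences\<close>

lemma acorr_of_int: "acorr n (\<lambda>i. of_int (f i)) k = of_int (acorr n f k)"
  by (simp add: acorr_def)

lemma sum_acorr_odd:
  fixes f :: "nat \<Rightarrow> int"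
  assumes "n = 2 * m + 1"
  shows "(\<Sum>i<n. f i)\<^sup>2 = acorr n f 0 + 2 * (\<Sum>k = 1..m. acorr n f k)"
proof -
  have "n div 2 = m" using assms by simp
  then have "real_of_int ((\<Sum>i<n. f i)\<^sup>2) = of_int (acorr n f 0 + 2 * (\<Sum>k = 1..m. acorr n f k))"
    using psd_0[OF assms, of "\<lambda>i. real_of_int (f i)"]
    by (simp add: psd_def acorr_of_int sum_distrib_left mult.commute)
  then show ?thesis by (simp only: of_int_eq_iff)
qed

text \<open>Modulo 2, \<open>g\<close> is \<open>1 + f\<close>, so the two products at one place add
  up to \<open>1 + f i + f ((i + k) mod n)\<close>. Over all \<open>i\<close> this sums to
  \<open>n\<close> plus twice the sum of \<open>f\<close>, which is odd.\<close>

lemma odd_acorr_complement: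
  fixes f g :: "nat \<Rightarrow> int"
  assumes n: "odd n" and fg: "\<And>i. i < n \<Longrightarrow> (f i)\<^sup>2 + (g i)\<^sup>2 = 1"
  shows "odd (acorr n f k + acorr n g k)"
proof -
  have pos: "n > 0" using n by (cases n) auto
  have par: "even (g i) \<longleftrightarrow> odd (f i)" if "i < n" for i
  proof -
    have "odd ((f i)\<^sup>2 + (g i)\<^sup>2)" using fg[OF that] by simp
    then show ?thesis by auto
  qed
  let ?s = "\<lambda>i. (i + k) mod n"
  have "even (\<Sum>i<n. f i * f (?s i) + g i * g (?s i) + 1 + f i + f (?s i))"
  proof (rule dvd_sum)
    fix i assume "i \<in> {..<n}"
    then have "i < n" "?s i < n" using pos by auto
    then show "even (f i * f (?s i) + g i * g (?s i) + 1 + f i + f (?s i))"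
      using par[of i] par[of "?s i"] by auto
  qed
  also have "(\<Sum>i<n. f i * f (?s i) + g i * g (?s i) + 1 + f i + f (?s i)) =
      acorr n f k + acorr n g k + int n + 2 * (\<Sum>i<n. f i)"
    by (simp add: sum.distrib acorr_def sum_circular_shift[OF pos])
  finally show ?thesis using n by simp
qed

section \<open>Circulant determinants of order 11\<close>

definition C :: "nat \<Rightarrow> nat \<Rightarrow> nat \<Rightarrow> real" where
  "C n j k = 2 * cos (2 * pi * real j * real k / real n)"

text \<open>Product-to-sum formula; \<open>max k l - min k l\<close> is the distance of
  \<open>k\<close> and \<open>l\<close> in the natural numbers.\<close>

lemma C_mult: "C n j k * C n j l = C n j (k + l) + C n j (max k l - min k l)"
proof -
  let ?x = "2 * pi * real j * real k / real n" and ?y = "2 * pi * real j * real l / real n"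
  have "C n j k * C n j l = 2 * (cos (?x + ?y) + cos (?x - ?y))"
    by (simp add: C_def cos_add cos_diff)
  moreover have "?x + ?y = 2 * pi * real j * real (k + l) / real n"
    by (simp add: distrib_left add_divide_distrib)
  moreover have "cos (?x - ?y) = cos (2 * pi * real j * real (max k l - min k l) / real n)"
  proof (cases "l \<le> k")
    case True
    then show ?thesis by (simp add: of_nat_diff right_diff_distrib diff_divide_distrib)
  next
    case False
    have "cos (?x - ?y) = cos (?y - ?x)" by (subst cos_minus[symmetric]) simp
    then show ?thesis using False by (simp add: of_nat_diff right_diff_distrib diff_divide_distrib)
  qed
  ultimately show ?thesis by (simp add: C_def distrib_left)
qed

lemma C_0: "C n j 0 = 2" by (simp add: C_def)

lemma C_reflect: "n > 0 \<Longrightarrow> k \<le> n \<Longrightarrow> C n j (n - k) = C n j k"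
  using cos_root_reflect[of n k j] by (simp add: C_def)

lemma C_mod: "n > 0 \<Longrightarrow> C n j (k mod n) = C n j k"
  using arg_cong[OF cis_root_mod[of n j k], of Re] by (simp add: C_def)

lemma C_commute: "C n j k = C n k j"
  by (simp add: C_def mult_ac)

lemma C_1: "C n j k = C n 1 (j * k)"
  by (simp add: C_def mult_ac)

lemma sum_C:
  assumes n: "n = 2 * m + 1" and j: "\<not> n dvd j"
  shows "(\<Sum>k = 1..m. C n j k) = -1"
proof -
  define g where "g k = cos (2 * pi * real j * real k / real n)" for k
  have pos: "n > 0" using n by simp
  have "0 = Re (\<Sum>k<n. cis (2 * pi * real j * real k / real n))"
    using sum_cis_root[OF pos j] by simp
  also have "\<dots> = sum g {..<n}" by (simp add: g_def)
  also have "\<dots> = g 0 + (\<Sum>k = 1..m. g k + g (n - k))"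
    unfolding n by (rule sum_odd_split)
  also have "(\<Sum>k = 1..m. g k + g (n - k)) = (\<Sum>k = 1..m. C n j k)"
  proof (intro sum.cong refl)
    fix k assume "k \<in> {1..m}"
    then have "k \<le> n" using n by simp
    then show "g k + g (n - k) = C n j k"
      using cos_root_reflect[OF pos, of k j] by (simp add: g_def C_def)
  qed
  finally show ?thesis by (simp add: g_def)
qed

lemma psd_C: "psd n a j = acorr n a 0 + (\<Sum>k = 1..n div 2. acorr n a k * C n j k)"
  by (simp add: psd_def C_def)

text \<open>A tuple \<open>(x\<^sub>1, \<dots>, x\<^sub>5)\<close> stands for \<open>\<Sum>k. x\<^sub>k * C 11 j k\<close>, for all \<open>j\<close> at once; \<open>tr5\<close> is the trace of a product.\<close>

fun mul5 :: "int \<times> int \<times> int \<times> int \<times> int \<Rightarrow> int \<times> int \<times> int \<times> int \<times> int \<Rightarrow> int \<times> int \<times> int \<times> int \<times> int" where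
  "mul5 (x1,x2,x3,x4,x5) (y1,y2,y3,y4,y5) =
    (let d = 2 * (x1*y1 + x2*y2 + x3*y3 + x4*y4 + x5*y5) in
      (x5*y5 + x1*y2 + x2*y1 + x2*y3 + x3*y2 + x3*y4 + x4*y3 + x4*y5 + x5*y4 - d,
       x1*y1 + x1*y3 + x3*y1 + x2*y4 + x4*y2 + x3*y5 + x5*y3 + x4*y5 + x5*y4 - d,
       x4*y4 + x1*y2 + x2*y1 + x1*y4 + x4*y1 + x2*y5 + x5*y2 + x3*y5 + x5*y3 - d,
       x2*y2 + x1*y3 + x3*y1 + x1*y5 + x5*y1 + x2*y5 + x5*y2 + x3*y4 + x4*y3 - d,
       x3*y3 + x1*y4 + x4*y1 + x1*y5 + x5*y1 + x2*y3 + x3*y2 + x2*y4 + x4*y2 - d))"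

fun tr5 :: "int \<times> int \<times> int \<times> int \<times> int \<Rightarrow> int \<times> int \<times> int \<times> int \<times> int \<Rightarrow> int" where
  "tr5 (x1,x2,x3,x4,x5) (y1,y2,y3,y4,y5) =
     11 * (x1*y1 + x2*y2 + x3*y3 + x4*y4 + x5*y5) - 2 * ((x1+x2+x3+x4+x5) * (y1+y2+y3+y4+y5))"

text \<open>The trace of the element coded by the tuple: over the five conjugates, each
  \<open>C 11 j k\<close> with \<open>k\<close> from 1 to 5 sums to -1
  (\<open>sum_val5\<close>).\<close>

fun el1 :: "int \<times> int \<times> int \<times> int \<times> int \<Rightarrow> int" where
  "el1 (x1,x2,x3,x4,x5) = - (x1+x2+x3+x4+x5)"

fun val5 :: "(nat \<Rightarrow> real) \<Rightarrow> int \<times> int \<times> int \<times> int \<times> int \<Rightarrow> real" where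
  "val5 c (x1,x2,x3,x4,x5) = of_int x1 * c 1 + of_int x2 * c 2 + of_int x3 * c 3 + of_int x4 * c 4 + of_int x5 * c 5"

text \<open>The product-to-sum formula with indices above 5 folded back by \<open>C_reflect\<close>;
  the constants 2 are \<open>C 11 j 0\<close>.\<close>

lemma C_11_mult:
  fixes j
  defines "c \<equiv> C 11 j"
  shows
    "c 1 * c 1 = c 2 + 2"
    "c 1 * c 2 = c 3 + c 1"
    "c 1 * c 3 = c 4 + c 2"
    "c 1 * c 4 = c 5 + c 3"
    "c 1 * c 5 = c 5 + c 4"
    "c 2 * c 2 = c 4 + 2"
    "c 2 * c 3 = c 5 + c 1"
    "c 2 * c 4 = c 5 + c 2"
    "c 2 * c 5 = c 4 + c 3"
    "c 3 * c 3 = c 5 + 2"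
    "c 3 * c 4 = c 4 + c 1"
    "c 3 * c 5 = c 3 + c 2"
    "c 4 * c 4 = c 3 + 2"
    "c 4 * c 5 = c 2 + c 1"
    "c 5 * c 5 = c 1 + 2"
  using C_reflect[of 11 5 j] C_reflect[of 11 4 j] C_reflect[of 11 3 j] C_reflect[of 11 2 j] C_reflect[of 11 1 j]
  by (simp_all add: c_def C_mult C_0 eval_nat_numeral)

lemma sum_1_5: "(\<Sum>k = 1..5. g k) = g 1 + g 2 + g 3 + g 4 + g 5"
  for g :: "nat \<Rightarrow> 'a::comm_monoid_add"
  by (simp add: eval_nat_numeral add_ac)

lemma prod_1_5: "(\<Prod>k = 1..5. g k) = g 1 * g 2 * g 3 * g 4 * g 5"
  for g :: "nat \<Rightarrow> 'a::comm_monoid_mult"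
  by (simp add: eval_nat_numeral mult_ac)

lemma val5_mul5:
  assumes "\<not> 11 dvd j"
  shows "val5 (C 11 j) (mul5 x y) = val5 (C 11 j) x * val5 (C 11 j) y"
proof -
  define c where "c = C 11 j"
  obtain x1 x2 x3 x4 x5 where x: "x = (x1,x2,x3,x4,x5)" by (metis prod_cases5)
  obtain y1 y2 y3 y4 y5 where y: "y = (y1,y2,y3,y4,y5)" by (metis prod_cases5)
  \<comment> \<open>The five values sum to -1, so the constant 2 from each square is minus twice
    their sum. This is the \<open>- d\<close> in all components of \<open>mul5\<close>.\<close>
  have s: "c 5 = - 1 - c 1 - c 2 - c 3 - c 4"
    using sum_C[of 11 5 j, unfolded sum_1_5] assms by (simp add: c_def)
  have "val5 c x * val5 c y = (x1 * y1) * (c 1 * c 1) + (x1 * y2 + x2 * y1) * (c 1 * c 2) + (x1 * y3 + x3 * y1) * (c 1 * c 3) + (x1 * y4 + x4 * y1) * (c 1 * c 4) + (x1 * y5 + x5 * y1) * (c 1 * c 5) + (x2 * y2) * (c 2 * c 2) + (x2 * y3 + x3 * y2) * (c 2 * c 3) + (x2 * y4 + x4 * y2) * (c 2 * c 4) + (x2 * y5 + x5 * y2) * (c 2 * c 5) + (x3 * y3) * (c 3 * c 3) + (x3 * y4 + x4 * y3) * (c 3 * c 4) + (x3 * y5 + x5 * y3) * (c 3 * c 5) + (x4 * y4) * (c 4 * c 4) + (x4 * y5 + x5 * y4) * (c 4 * c 5) + (x5 * y5) * (c 5 * c 5)"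
    unfolding x y by (simp add: algebra_simps)
  also have "\<dots> = val5 c (mul5 x y)"
    unfolding c_def C_11_mult unfolding c_def[symmetric] x y
    by (simp add: Let_def s) (simp add: algebra_simps)
  finally show ?thesis by (simp add: c_def)
qed

lemma sum_val5: "(\<Sum>j = 1..5. val5 (C 11 j) x) = of_int (el1 x)"
proof -
  obtain x1 x2 x3 x4 x5 where x: "x = (x1,x2,x3,x4,x5)" by (metis prod_cases5)
  have "(\<Sum>j = 1..5. C 11 j k) = -1" if "k \<in> {1..5}" for k
  proof -
    have "\<not> 11 dvd k" using that by (auto dest: dvd_imp_le)
    then show ?thesis using sum_C[of 11 5 k] by (simp add: C_commute[of 11 _ k])
  qed
  note S = this[of 1] this[of 2] this[of 3] this[of 4] this[of 5]
  have "(\<Sum>j = 1..5. val5 (C 11 j) x) = of_int x1 * (\<Sum>j = 1..5. C 11 j 1) + of_int x2 * (\<Sum>j = 1..5. C 11 j 2)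
     + of_int x3 * (\<Sum>j = 1..5. C 11 j 3) + of_int x4 * (\<Sum>j = 1..5. C 11 j 4) + of_int x5 * (\<Sum>j = 1..5. C 11 j 5)"
    unfolding x by (simp only: val5.simps sum.distrib sum_distrib_left)
  then show ?thesis using S unfolding x by simp
qed

lemma sum_val5_mult: "(\<Sum>j = 1..5. val5 (C 11 j) x * val5 (C 11 j) y) = of_int (tr5 x y)"
proof -
  obtain x1 x2 x3 x4 x5 where x: "x = (x1,x2,x3,x4,x5)" by (metis prod_cases5)
  obtain y1 y2 y3 y4 y5 where y: "y = (y1,y2,y3,y4,y5)" by (metis prod_cases5)
  have "(\<Sum>j = 1..5. val5 (C 11 j) x * val5 (C 11 j) y) = (\<Sum>j = 1..5. val5 (C 11 j) (mul5 x y))"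
    by (intro sum.cong refl val5_mul5[symmetric]) (auto dest: dvd_imp_le)
  also have "\<dots> = of_int (el1 (mul5 x y))" by (rule sum_val5)
  also have "el1 (mul5 x y) = tr5 x y"
    unfolding x y by (simp add: Let_def algebra_simps)
  finally show ?thesis .
qed

text \<open>By Newton's identities, the components of \<open>el s x\<close> are \<open>6 e\<^sub>3\<close>, \<open>24 e\<^sub>4\<close> and \<open>120 e\<^sub>5\<close>, where
  \<open>e\<^sub>k\<close> is the elementary symmetric polynomial in the five conjugates of \<open>s + x\<close>.\<close>

definition el :: "int \<Rightarrow> int \<times> int \<times> int \<times> int \<times> int \<Rightarrow> int \<times> int \<times> int" where
  "el s x = (let y = mul5 x x; z = mul5 y x;
      p1 = el1 x; p2 = tr5 x x; p3 = tr5 x y; p4 = tr5 y y; p5 = tr5 y z;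
      e2 = p1*p1 - p2; e3 = p1*e2 - 2*(p2*p1 - p3);
      e4 = p1*e3 - 3*(p2*e2) + 6*(p3*p1 - p4);
      e5 = p1*e4 - 4*(p2*e3) + 12*(p3*e2) - 24*(p4*p1) + 24*p5
    in (60*s*s*s + 36*s*s*p1 + 9*s*e2 + e3,
        120*s*s*s*s + 96*s*s*s*p1 + 36*s*s*e2 + 8*s*e3 + e4,
        120*s*s*s*s*s + 120*s*s*s*s*p1 + 60*s*s*s*e2 + 20*s*s*e3 + 5*s*e4 + e5))"

text \<open>With \<open>s\<close> the weight and \<open>x\<close> the autocorrelations of a
  sequence, these are its power spectrum values (\<open>psd_11\<close>).\<close>

definition \<alpha> :: "int \<Rightarrow> int \<times> int \<times> int \<times> int \<times> int \<Rightarrow> nat \<Rightarrow> real" where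
  "\<alpha> s x j = of_int s + val5 (C 11 j) x"

text \<open>Newton's identities, multiplied by factorials so that no division occurs and the
  recursion can run over the integers.\<close>

lemma newton_5:
  fixes a b c d e :: real
  defines "p1 \<equiv> a+b+c+d+e" and "p2 \<equiv> a^2+b^2+c^2+d^2+e^2" and "p3 \<equiv> a^3+b^3+c^3+d^3+e^3"
    and "p4 \<equiv> a^4+b^4+c^4+d^4+e^4" and "p5 \<equiv> a^5+b^5+c^5+d^5+e^5"
    and "e2 \<equiv> a*b+a*c+a*d+a*e+b*c+b*d+b*e+c*d+c*e+d*e"
    and "e3 \<equiv> a*b*c+a*b*d+a*b*e+a*c*d+a*c*e+a*d*e+b*c*d+b*c*e+b*d*e+c*d*e"
    and "e4 \<equiv> a*b*c*d+a*b*c*e+a*b*d*e+a*c*d*e+b*c*d*e"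
  shows "p1*p1 - p2 = 2*e2"
    and "p1*(2*e2) - 2*(p2*p1 - p3) = 6*e3"
    and "p1*(6*e3) - 3*(p2*(2*e2)) + 6*(p3*p1 - p4) = 24*e4"
    and "p1*(24*e4) - 4*(p2*(6*e3)) + 12*(p3*(2*e2)) - 24*(p4*p1) + 24*p5 = 120*(a*b*c*d*e)"
  unfolding assms by (simp_all add: algebra_simps eval_nat_numeral)

text \<open>Traces give the power sums of the conjugates \<open>v\<close>, and Newton's identities
  their elementary symmetric polynomials \<open>S2\<close> to \<open>S5\<close>. Adding
  \<open>s\<close> to each conjugate yields the coefficients in \<open>el\<close>. The last claim is
  the second symmetric polynomial, for Maclaurin's inequality.\<close>

lemma el_correct:
  fixes s x
  defines "a \<equiv> \<alpha> s x"
  shows "of_int (fst (el s x)) = 6 * (a 1*a 2*a 3+a 1*a 2*a 4+a 1*a 2*a 5+a 1*a 3*a 4+a 1*a 3*a 5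
      +a 1*a 4*a 5+a 2*a 3*a 4+a 2*a 3*a 5+a 2*a 4*a 5+a 3*a 4*a 5)" (is "_ = 6 * ?E3")
    and "of_int (fst (snd (el s x))) = 24 * (a 1*a 2*a 3*a 4+a 1*a 2*a 3*a 5+a 1*a 2*a 4*a 5
      +a 1*a 3*a 4*a 5+a 2*a 3*a 4*a 5)" (is "_ = 24 * ?E4")
    and "of_int (snd (snd (el s x))) = 120 * (a 1*a 2*a 3*a 4*a 5)" (is "_ = 120 * ?E5")
    and "of_int (20*s*s + 8*s*el1 x + el1 x*el1 x - tr5 x x) =
      2 * (a 1*a 2+a 1*a 3+a 1*a 4+a 1*a 5+a 2*a 3+a 2*a 4+a 2*a 5+a 3*a 4+a 3*a 5+a 4*a 5)" (is "_ = 2 * ?E2")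
proof -
  define v where "v j = val5 (C 11 j) x" for j
  have a: "a j = of_int s + v j" for j by (simp add: a_def \<alpha>_def v_def)
  have m: "val5 (C 11 j) (mul5 x x) = v j * v j" "val5 (C 11 j) (mul5 (mul5 x x) x) = v j * v j * v j"
    if "j \<in> {1..5}" for j
  proof -
    have "\<not> 11 dvd j" using that by (auto dest: dvd_imp_le)
    then show "val5 (C 11 j) (mul5 x x) = v j * v j" "val5 (C 11 j) (mul5 (mul5 x x) x) = v j * v j * v j"
      by (simp_all add: val5_mul5 v_def)
  qed
  have M: "val5 (C 11 j) (mul5 x x) = v j * v j" "val5 (C 11 j) (mul5 (mul5 x x) x) = v j * v j * v j"
    if "j = Suc 0 \<or> j = 2 \<or> j = 3 \<or> j = 4 \<or> j = 5" for j
    using m[of j] that by auto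
  have p1: "real_of_int (el1 x) = v 1 + v 2 + v 3 + v 4 + v 5"
    using sum_val5[of x] by (simp add: sum_1_5 v_def del: One_nat_def)
  have p2: "real_of_int (tr5 x x) = v 1^2 + v 2^2 + v 3^2 + v 4^2 + v 5^2"
    using sum_val5_mult[of x x] by (simp add: sum_1_5 v_def power2_eq_square del: One_nat_def)
  have p3: "real_of_int (tr5 x (mul5 x x)) = v 1^3 + v 2^3 + v 3^3 + v 4^3 + v 5^3"
    unfolding sum_val5_mult[symmetric] sum_1_5 v_def[symmetric] by (simp add: M power_numeral_reduce)
  have p4: "real_of_int (tr5 (mul5 x x) (mul5 x x)) = v 1^4 + v 2^4 + v 3^4 + v 4^4 + v 5^4"
    unfolding sum_val5_mult[symmetric] sum_1_5 by (simp add: M power_numeral_reduce)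
  have p5: "real_of_int (tr5 (mul5 x x) (mul5 (mul5 x x) x)) = v 1^5 + v 2^5 + v 3^5 + v 4^5 + v 5^5"
    unfolding sum_val5_mult[symmetric] sum_1_5 by (simp add: M power_numeral_reduce)
  define e2 where "e2 = el1 x*el1 x - tr5 x x"
  define e3 where "e3 = el1 x*e2 - 2*(tr5 x x*el1 x - tr5 x (mul5 x x))"
  define e4 where "e4 = el1 x*e3 - 3*(tr5 x x*e2) + 6*(tr5 x (mul5 x x)*el1 x - tr5 (mul5 x x) (mul5 x x))"
  define e5 where "e5 = el1 x*e4 - 4*(tr5 x x*e3) + 12*(tr5 x (mul5 x x)*e2)
    - 24*(tr5 (mul5 x x) (mul5 x x)*el1 x) + 24*tr5 (mul5 x x) (mul5 (mul5 x x) x)"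
  have el: "el s x = (60*s*s*s + 36*s*s*el1 x + 9*s*e2 + e3,
        120*s*s*s*s + 96*s*s*s*el1 x + 36*s*s*e2 + 8*s*e3 + e4,
        120*s*s*s*s*s + 120*s*s*s*s*el1 x + 60*s*s*s*e2 + 20*s*s*e3 + 5*s*e4 + e5)"
    unfolding el_def Let_def e2_def e3_def e4_def e5_def ..
  define S2 where "S2 = v 1*v 2+v 1*v 3+v 1*v 4+v 1*v 5+v 2*v 3+v 2*v 4+v 2*v 5+v 3*v 4+v 3*v 5+v 4*v 5"
  define S3 where "S3 = v 1*v 2*v 3+v 1*v 2*v 4+v 1*v 2*v 5+v 1*v 3*v 4+v 1*v 3*v 5+v 1*v 4*v 5+v 2*v 3*v 4+v 2*v 3*v 5+v 2*v 4*v 5+v 3*v 4*v 5"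
  define S4 where "S4 = v 1*v 2*v 3*v 4+v 1*v 2*v 3*v 5+v 1*v 2*v 4*v 5+v 1*v 3*v 4*v 5+v 2*v 3*v 4*v 5"
  define S5 where "S5 = v 1*v 2*v 3*v 4*v 5"
  note N = newton_5[of "v 1" "v 2" "v 3" "v 4" "v 5", folded p1 p2 p3 p4 p5 S2_def S3_def S4_def S5_def]
  have e2: "real_of_int e2 = 2*S2" using N(1) by (simp add: e2_def)
  have e3: "real_of_int e3 = 6*S3" using N(2) by (simp add: e3_def e2)
  have e4: "real_of_int e4 = 24*S4" using N(3) by (simp add: e4_def e2 e3)
  have e5: "real_of_int e5 = 120*S5" using N(4) by (simp add: e5_def e2 e3 e4)
  show "of_int (fst (el s x)) = 6 * ?E3"
    by (simp add: el e2 e3) (simp add: p1 a S2_def S3_def algebra_simps)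
  show "of_int (fst (snd (el s x))) = 24 * ?E4"
    by (simp add: el e2 e3 e4) (simp add: p1 a S2_def S3_def S4_def algebra_simps)
  show "of_int (snd (snd (el s x))) = 120 * ?E5"
    by (simp add: el e2 e3 e4 e5) (simp add: p1 a S2_def S3_def S4_def S5_def algebra_simps)
  show "of_int (20*s*s + 8*s*el1 x + el1 x*el1 x - tr5 x x) = 2 * ?E2"
    using e2 by (simp add: e2_def p1 a S2_def algebra_simps)
qed

section \<open>Inequalities between elementary symmetric polynomials\<close>

lemma prod_le_power_mean:
  fixes x :: "'b \<Rightarrow> real"
  assumes "finite A" "A \<noteq> {}" and x: "\<And>i. i \<in> A \<Longrightarrow> x i \<ge> 0"
  shows "prod x A \<le> (sum x A / card A) ^ card A"
proof (cases "sum x A = 0")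
  case True
  then have "\<forall>i\<in>A. x i = 0" using assms by (simp add: sum_nonneg_eq_0_iff)
  then show ?thesis using assms True by (auto simp: card_gt_0_iff)
next
  case False
  define m where "m = sum x A / card A"
  have card: "card A > 0" using assms(1,2) by (simp add: card_gt_0_iff)
  have "sum x A > 0" using False sum_nonneg[of A x] x by fastforce
  then have m: "m > 0" using card by (simp add: m_def)
  \<comment> \<open>The tangent inequality \<open>y \<le> exp (y - 1)\<close> at
    \<open>y = x i / m\<close>; the exponents sum to 0 because \<open>m\<close> is the mean.\<close>
  have "(\<Prod>i\<in>A. x i / m) \<le> (\<Prod>i\<in>A. exp (x i / m - 1))"
  proof (rule prod_mono)
    fix i assume "i \<in> A"
    then show "0 \<le> x i / m \<and> x i / m \<le> exp (x i / m - 1)"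
      using x m exp_ge_add_one_self[of "x i / m - 1"] by simp
  qed
  also have "\<dots> = exp (\<Sum>i\<in>A. x i / m - 1)" using assms(1) by (rule exp_sum[symmetric])
  also have "(\<Sum>i\<in>A. x i / m - 1) = 0"
  proof -
    have "sum x A / m = card A" using False card by (simp add: m_def)
    then show ?thesis by (simp add: sum_subtractf flip: sum_divide_distrib)
  qed
  finally show ?thesis using m by (simp add: prod_dividef m_def[symmetric] field_simps)
qed

lemma prod_list_le_power_mean:
  fixes l :: "real list"
  assumes "l \<noteq> []" "\<And>y. y \<in> set l \<Longrightarrow> y \<ge> 0"
  shows "prod_list l \<le> (sum_list l / length l) ^ length l"
proof -
  have "prod ((!) l) {0..<length l} \<le> (sum ((!) l) {0..<length l} / card {0..<length l}) ^ card {0..<length l}"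
    using assms by (intro prod_le_power_mean) (simp_all add: atLeastLessThan_iff)
  then show ?thesis
    by (simp add: prod.list_conv_set_nth sum_list_sum_nth)
qed

lemma prod_5_le:
  fixes a b c d e :: real
  assumes "a \<ge> 0" "b \<ge> 0" "c \<ge> 0" "d \<ge> 0" "e \<ge> 0"
  shows "3125 * (a*b*c*d*e) \<le> (a+b+c+d+e)^5"
proof -
  define E where "E = a+b+c+d+e"
  have "prod_list [a,b,c,d,e] \<le> (sum_list [a,b,c,d,e] / length [a,b,c,d,e]) ^ length [a,b,c,d,e]"
    by (rule prod_list_le_power_mean) (use assms in auto)
  moreover have "prod_list [a,b,c,d,e] = a*b*c*d*e" "sum_list [a,b,c,d,e] = E" "length [a,b,c,d,e] = 5"
    by (simp_all add: E_def)
  ultimately have "a*b*c*d*e \<le> (E / 5) ^ 5" by (simp only: of_nat_numeral)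
  then show ?thesis by (simp add: power_divide E_def)
qed

text \<open>Maclaurin's inequality between \<open>e\<^sub>5\<close> and \<open>e\<^sub>2\<close>: apply AM-GM to the ten products of pairs.\<close>

lemma prod_5_sq_le:
  fixes a b c d e :: real
  assumes nn: "a \<ge> 0" "b \<ge> 0" "c \<ge> 0" "d \<ge> 0" "e \<ge> 0"
  shows "3200000 * (a*b*c*d*e)^2 \<le> (2 * (a*b+a*c+a*d+a*e+b*c+b*d+b*e+c*d+c*e+d*e))^5"
proof -
  define l where "l = [a*b,a*c,a*d,a*e,b*c,b*d,b*e,c*d,c*e,d*e]"
  define E where "E = a*b+a*c+a*d+a*e+b*c+b*d+b*e+c*d+c*e+d*e"
  have "prod_list l \<le> (sum_list l / length l) ^ length l"
  proof (rule prod_list_le_power_mean)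
    show "l \<noteq> []" by (simp add: l_def)
    fix y assume "y \<in> set l"
    then show "y \<ge> 0" unfolding l_def using nn by auto
  qed
  moreover have "length l = 10" by (simp add: l_def)
  \<comment> \<open>Each of the five numbers occurs in four of the ten pairs.\<close>
  moreover have "prod_list l = ((a*b*c*d*e)^2)^2" by (simp add: l_def power2_eq_square mult_ac)
  moreover have "sum_list l = E" by (simp add: l_def E_def)
  ultimately have "((a*b*c*d*e)^2)^2 \<le> (E/10)^10" by (simp only: of_nat_numeral)
  also have "(E/10)^10 = ((E/10)^5)^2" by (simp only: flip: power_mult) simp
  finally have "((a*b*c*d*e)^2)^2 \<le> ((E/10)^5)^2" .
  moreover have "E \<ge> 0" using nn by (simp add: E_def)
  ultimately have "(a*b*c*d*e)^2 \<le> (E/10)^5" by (intro power2_le_imp_le[of "(a*b*c*d*e)^2"]) simp_all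
  then have "3200000 * (a*b*c*d*e)^2 \<le> 3200000 * (E/10)^5" by simp
  also have "\<dots> = (2 * E)^5" by (simp add: power_divide power_mult_distrib)
  finally show ?thesis by (simp add: E_def)
qed

section \<open>Integer determinants of order 11 through autocorrelations\<close>

lemma det_circ_of_int:
  "real_of_int (det (circ (vec n f))) = det (circ (vec n (\<lambda>i. real_of_int (f i))))"
proof -
  have "map_mat real_of_int (circ (vec n f)) = circ (vec n (\<lambda>i. real_of_int (f i)))"
    by (intro eq_matI) (simp_all add: circ_vec_index)
  then show ?thesis by (metis of_int_hom.hom_det)
qed

definition corr5 :: "(nat \<Rightarrow> int) \<Rightarrow> int \<times> int \<times> int \<times> int \<times> int" where
  "corr5 f = (acorr 11 f 1, acorr 11 f 2, acorr 11 f 3, acorr 11 f 4, acorr 11 f 5)"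

lemma psd_11: "psd 11 (\<lambda>i. real_of_int (f i)) j = \<alpha> (acorr 11 f 0) (corr5 f) j"
  by (simp add: psd_C sum_1_5 \<alpha>_def corr5_def acorr_of_int del: One_nat_def)

lemma \<alpha>_nonneg: "\<alpha> (acorr 11 f 0) (corr5 f) j \<ge> 0"
  unfolding psd_11[symmetric] by (rule psd_nonneg[of 11 5]) simp

lemma det_circ_11: "120 * det (circ (vec 11 f)) = (\<Sum>i<11. f i) * snd (snd (el (acorr 11 f 0) (corr5 f)))"
proof -
  have "real_of_int (120 * det (circ (vec 11 f))) = of_int (\<Sum>i<11. f i) * of_int (snd (snd (el (acorr 11 f 0) (corr5 f))))"
    unfolding el_correct by (simp add: det_circ_of_int det_circ_odd[of 11 5] prod_1_5 psd_11 del: One_nat_def)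
  then show ?thesis by (simp only: of_int_eq_iff flip: of_int_mult)
qed

lemma el_nonneg:
  fixes f
  defines "E \<equiv> el (acorr 11 f 0) (corr5 f)"
  shows "fst E \<ge> 0" "fst (snd E) \<ge> 0" "snd (snd E) \<ge> 0"
proof -
  note nn = \<alpha>_nonneg[of f]
  have "real_of_int (fst E) \<ge> 0" "real_of_int (fst (snd E)) \<ge> 0" "real_of_int (snd (snd E)) \<ge> 0"
    unfolding E_def el_correct by (simp_all add: nn)
  then show "fst E \<ge> 0" "fst (snd E) \<ge> 0" "snd (snd E) \<ge> 0" by simp_all
qed

text \<open>AM-GM and Maclaurin for the five power spectrum values, whose sum is
  \<open>5 * s - T\<close>. \<open>T\<close> is the sum of the autocorrelations, and the base of the
  second fifth power is twice the second elementary symmetric polynomial.\<close>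

lemma det_circ_11_le:
  fixes f
  defines "s \<equiv> acorr 11 f 0" and "t \<equiv> \<bar>\<Sum>i<11. f i\<bar>" and "D \<equiv> \<bar>det (circ (vec 11 f))\<bar>"
    and "T \<equiv> - el1 (corr5 f)"
  shows "3125 * D \<le> t * (5 * s - T)^5"
    and "3200000 * D^2 \<le> t^2 * (20*s*s - 8*s*T + T*T - tr5 (corr5 f) (corr5 f))^5"
    and "20*s*s - 8*s*T + T*T - tr5 (corr5 f) (corr5 f) \<ge> 0"
    and "5 * s - T \<ge> 0"
proof -
  define a where "a = \<alpha> s (corr5 f)"
  have nn: "a j \<ge> 0" for j unfolding a_def s_def by (rule \<alpha>_nonneg)
  have D: "real_of_int D = of_int t * (a 1*a 2*a 3*a 4*a 5)"
  proof -
    have "real_of_int (det (circ (vec 11 f))) = of_int (\<Sum>i<11. f i) * (a 1*a 2*a 3*a 4*a 5)"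
      by (simp add: det_circ_of_int det_circ_odd[of 11 5] prod_1_5 psd_11 a_def s_def del: One_nat_def)
    then show ?thesis by (simp add: D_def t_def abs_mult nn)
  qed
  have t: "t \<ge> 0" by (simp add: t_def)
  have e1: "of_int (5 * s - T) = a 1 + a 2 + a 3 + a 4 + a 5"
    using sum_val5[of "corr5 f"] by (simp add: T_def sum_1_5 a_def \<alpha>_def del: One_nat_def)
  have e2: "real_of_int (20*s*s - 8*s*T + T*T - tr5 (corr5 f) (corr5 f)) =
    2 * (a 1*a 2+a 1*a 3+a 1*a 4+a 1*a 5+a 2*a 3+a 2*a 4+a 2*a 5+a 3*a 4+a 3*a 5+a 4*a 5)"
    unfolding a_def el_correct(4)[symmetric] by (simp add: T_def)
  have "real_of_int (5 * s - T) \<ge> 0" unfolding e1 by (simp add: nn)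
  then show "5 * s - T \<ge> 0" by simp
  have "real_of_int (20*s*s - 8*s*T + T*T - tr5 (corr5 f) (corr5 f)) \<ge> 0"
    unfolding e2 by (simp add: nn)
  then show "20*s*s - 8*s*T + T*T - tr5 (corr5 f) (corr5 f) \<ge> 0" by (simp only: of_int_0_le_iff)
  have "real_of_int (3125 * D) = of_int t * (3125 * (a 1*a 2*a 3*a 4*a 5))" by (simp add: D)
  also have "\<dots> \<le> of_int t * of_int (5 * s - T)^5"
    unfolding e1 using t by (intro mult_left_mono prod_5_le nn) simp
  finally show "3125 * D \<le> t * (5 * s - T)^5"
    by (simp only: of_int_le_iff flip: of_int_mult of_int_power)
  have "real_of_int (3200000 * D^2) = (of_int t)^2 * (3200000 * (a 1*a 2*a 3*a 4*a 5)^2)"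
    by (simp add: D power_mult_distrib)
  also have "\<dots> \<le> (of_int t)^2 * of_int (20*s*s - 8*s*T + T*T - tr5 (corr5 f) (corr5 f))^5"
    unfolding e2 using t by (intro mult_left_mono prod_5_sq_le nn) simp
  finally show "3200000 * D^2 \<le> t^2 * (20*s*s - 8*s*T + T*T - tr5 (corr5 f) (corr5 f))^5"
    by (simp only: of_int_le_iff flip: of_int_mult of_int_power)
qed

text \<open>All integer lists of length \<open>n\<close> with sum \<open>T\<close> and sum of squares at most \<open>Q < 25\<close>;
  the test \<open>T * T > n * Q\<close> prunes by Cauchy--Schwarz.\<close>

fun bounded_lists :: "nat \<Rightarrow> int \<Rightarrow> int \<Rightarrow> int list list" where
  "bounded_lists 0 T Q = (if T = 0 then [[]] else [])"
| "bounded_lists (Suc n) T Q = (if T*T > int (Suc n) * Q then [] else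
     concat (map (\<lambda>x. map ((#) x) (bounded_lists n (T-x) (Q-x*x)))
       (filter (\<lambda>x. x*x \<le> Q) [-4,-3,-2,-1,0,1,2,3,4])))"

text \<open>Cauchy-Schwarz against the constant 1; in the induction the cross term
  \<open>2*x*S\<close> is controlled by the square of \<open>n*x - S\<close>.\<close>

lemma sum_list_sq_le:
  fixes xs :: "int list"
  shows "(sum_list xs)\<^sup>2 \<le> int (length xs) * sum_list (map (\<lambda>x. x*x) xs)"
proof (induction xs)
  case (Cons x xs)
  define n S Q where "n = int (length xs)" and "S = sum_list xs" and "Q = sum_list (map (\<lambda>x. x*x) xs)"
  have IH: "S\<^sup>2 \<le> n * Q" using Cons by (simp add: n_def S_def Q_def)
  have "2*x*S \<le> n*x\<^sup>2 + Q"
  proof (cases "n = 0")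
    case True
    then show ?thesis by (simp add: n_def S_def Q_def)
  next
    case False
    then have n: "n > 0" by (simp add: n_def)
    have "n * (2*x*S) \<le> (n*x)\<^sup>2 + S\<^sup>2"
      using zero_le_power2[of "n*x - S"] by (simp add: power2_diff mult_ac)
    also have "\<dots> \<le> n * (n*x\<^sup>2 + Q)"
      using IH by (simp add: algebra_simps power2_eq_square)
    finally show ?thesis using n by simp
  qed
  then have "x\<^sup>2 + 2*x*S + S\<^sup>2 \<le> (n + 1) * (x\<^sup>2 + Q)"
    using IH by (simp add: algebra_simps)
  then show ?case
    by (simp add: n_def S_def Q_def power2_sum power2_eq_square algebra_simps)
qed simp

lemma Cons_mem_concat_map:
  "ys \<in> set (g x) \<Longrightarrow> P x \<Longrightarrow> x \<in> set L \<Longrightarrow>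
    x # ys \<in> set (concat (map (\<lambda>x. map ((#) x) (g x)) (filter P L)))"
  by auto

lemma bounded_lists_complete:
  assumes "length xs = n" "sum_list xs = T" "sum_list (map (\<lambda>x. x*x) xs) \<le> Q" "Q < 25"
  shows "xs \<in> set (bounded_lists n T Q)"
  using assms
proof (induction n arbitrary: xs T Q)
  case (Suc n)
  from Suc.prems(1) obtain x ys where xs: "xs = x # ys" by (auto simp: length_Suc_conv)
  let ?Q = "sum_list (map (\<lambda>x. x*x) ys)"
  have Q0: "?Q \<ge> 0" by (intro sum_list_nonneg) auto
  have "T*T \<le> int (Suc n) * sum_list (map (\<lambda>x. x*x) xs)"
    using sum_list_sq_le[of xs] Suc.prems(1,2) by (simp add: power2_eq_square)
  also have "\<dots> \<le> int (Suc n) * Q" using Suc.prems(3) by (intro mult_left_mono) auto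
  finally have "\<not> T*T > int (Suc n) * Q" by simp
  moreover have "ys \<in> set (bounded_lists n (T - x) (Q - x*x))"
  proof (rule Suc.IH)
    have "0 \<le> x*x" by simp
    then show "Q - x*x < 25" using Suc.prems(4) by linarith
  qed (use Suc.prems xs in auto)
  moreover have xQ: "x*x \<le> Q" using Suc.prems(3) Q0 xs by simp
  moreover have "x \<in> set [-4,-3,-2,-1,0,1,2,3,4]"
  proof -
    \<comment> \<open>Since \<open>x*x \<le> Q < 25\<close>, the fixed range from -4 to 4 in
      \<open>bounded_lists\<close> is exhaustive.\<close>
    have "\<bar>x\<bar> < 5"
    proof (rule ccontr)
      assume "\<not> \<bar>x\<bar> < 5"
      then have "5*5 \<le> \<bar>x\<bar>*\<bar>x\<bar>" by (intro mult_mono) auto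
      then show False using xQ Suc.prems(4) by simp
    qed
    then have "x = -4 \<or> x = -3 \<or> x = -2 \<or> x = -1 \<or> x = 0 \<or> x = 1 \<or> x = 2 \<or> x = 3 \<or> x = 4" by arith
    then show ?thesis by (simp add: disj_ac)
  qed
  ultimately show ?case
    unfolding xs bounded_lists.simps
    by (subst if_not_P) (assumption, rule Cons_mem_concat_map)
qed auto

fun tup :: "int list \<Rightarrow> int \<times> int \<times> int \<times> int \<times> int" where
  "tup [a,b,c,d,e] = (a,b,c,d,e)"
| "tup _ = (0,0,0,0,0)"

text \<open>The candidate autocorrelations \<open>c\<close> of a ternary sequence of weight \<open>s\<close> and sum \<open>t\<close>, paired with the
  value 120 times the determinant would have: the components of \<open>el\<close> must be nonnegative because they are
  symmetric functions of squared absolute values.\<close>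

definition candidates :: "(int list \<Rightarrow> bool) \<Rightarrow> int \<Rightarrow> int \<Rightarrow> int \<Rightarrow> int \<Rightarrow> int \<Rightarrow> (int list \<times> int) list" where
  "candidates P s t T Q low = concat (map (\<lambda>c. case el s (tup c) of (e3, e4, e5) \<Rightarrow>
     if 0 \<le> e3 \<and> 0 \<le> e4 \<and> 120*low \<le> t*e5 then [(c, t*e5)] else []) (filter P (bounded_lists 5 T Q)))"

definition corr_list :: "(nat \<Rightarrow> int) \<Rightarrow> int list" where
  "corr_list f = [acorr 11 f 1, acorr 11 f 2, acorr 11 f 3, acorr 11 f 4, acorr 11 f 5]"

lemma tup_corr_list: "tup (corr_list f) = corr5 f"
  by (simp add: corr_list_def corr5_def)

lemma sum_sq_11:
  "(\<Sum>i<11. f i)\<^sup>2 = acorr 11 f 0 + 2 * sum_list (corr_list f)" for f :: "nat \<Rightarrow> int"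
  using sum_acorr_odd[of 11 5 f] by (simp add: sum_1_5 corr_list_def del: One_nat_def)

text \<open>Assumption \<open>Q\<close> says that a sum of squares above the cutoff pushes the
  Maclaurin bound below \<open>low\<close>. Hence a determinant of at least \<open>low\<close> has
  its autocorrelations in the enumerated list, and they pass the sign tests.\<close>

lemma candidates_complete:
  fixes f :: "nat \<Rightarrow> int"
  defines "D \<equiv> \<bar>det (circ (vec 11 f))\<bar>"
  assumes s: "acorr 11 f 0 = s" and t: "\<bar>\<Sum>i<11. f i\<bar> = t" and T: "t*t = s + 2*T"
    and P: "P (corr_list f)" and low: "low \<le> D" "0 \<le> low"
    and Q: "t\<^sup>2 * (max 0 (20*s*s - 8*s*T + 3*T*T - 11*(Q+1)))^5 < 3200000*low\<^sup>2" "Q < 25"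
  shows "(corr_list f, 120*D) \<in> set (candidates P s t T Q low)"
proof -
  define q where "q = sum_list (map (\<lambda>x. x*x) (corr_list f))"
  have t0: "t \<ge> 0" using t by simp
  have "t*t = (\<Sum>i<11. f i)\<^sup>2" using t by (metis abs_mult_self_eq power2_eq_square)
  then have T': "sum_list (corr_list f) = T" using T s sum_sq_11[of f] by simp
  then have el1: "el1 (corr5 f) = - T" by (simp add: corr_list_def corr5_def)
  have tr: "tr5 (corr5 f) (corr5 f) = 11*q - 2*(T*T)"
    unfolding T'[symmetric] q_def by (simp add: corr_list_def corr5_def add.assoc)
  define M where "M = 20*s*s - 8*s*T + 3*T*T - 11*q"
  note D = det_circ_11_le[of f, folded D_def, unfolded s t el1 tr]
  have M: "M \<ge> 0" "3200000*D\<^sup>2 \<le> t\<^sup>2 * M^5"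
    using D(2,3) by (simp_all add: M_def algebra_simps)
  have "q \<le> Q"
  proof (rule ccontr)
    assume "\<not> q \<le> Q"
    then have "M \<le> max 0 (20*s*s - 8*s*T + 3*T*T - 11*(Q+1))" by (simp add: M_def)
    then have "M^5 \<le> (max 0 (20*s*s - 8*s*T + 3*T*T - 11*(Q+1)))^5" using M(1) by (intro power_mono)
    then have "t\<^sup>2 * M^5 \<le> t\<^sup>2 * (max 0 (20*s*s - 8*s*T + 3*T*T - 11*(Q+1)))^5"
      by (intro mult_left_mono) auto
    also have "\<dots> < 3200000*low\<^sup>2" by (rule Q(1))
    also have "\<dots> \<le> 3200000*D\<^sup>2" using low by (intro mult_left_mono power_mono) auto
    finally show False using M(2) by simp
  qed
  then have "corr_list f \<in> set (bounded_lists 5 T Q)"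
    using T' Q(2) by (intro bounded_lists_complete) (simp_all add: q_def, simp add: corr_list_def)
  moreover obtain e3 e4 e5 where e: "el s (tup (corr_list f)) = (e3, e4, e5)"
    by (metis prod_cases3)
  have e': "el (acorr 11 f 0) (corr5 f) = (e3, e4, e5)" using e by (simp add: s tup_corr_list)
  have nn: "e3 \<ge> 0" "e4 \<ge> 0" "e5 \<ge> 0" using el_nonneg[of f] unfolding e' by simp_all
  have "120 * det (circ (vec 11 f)) = (\<Sum>i<11. f i) * e5"
    using det_circ_11[of f] unfolding e' by simp
  then have "\<bar>120 * det (circ (vec 11 f))\<bar> = \<bar>(\<Sum>i<11. f i) * e5\<bar>" by simp
  then have "120*D = t*e5" using nn(3) t by (simp add: abs_mult D_def)
  moreover have "120*low \<le> 120*D" using low by simp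
  ultimately show ?thesis
    unfolding candidates_def using P e nn by (auto intro!: bexI[of _ "corr_list f"])
qed

section \<open>Exhaustive search over supports and signs\<close>

fun supports :: "nat \<Rightarrow> nat \<Rightarrow> bool list list" where
  "supports 0 w = (if w = 0 then [[]] else [])"
| "supports (Suc n) w = map ((#) False) (supports n w) @
     (case w of 0 \<Rightarrow> [] | Suc v \<Rightarrow> map ((#) True) (supports n v))"

fun signings :: "bool list \<Rightarrow> int list list" where
  "signings [] = [[]]"
| "signings (b # bs) = (if b then map ((#) 1) (signings bs) @ map ((#) (-1)) (signings bs)
     else map ((#) 0) (signings bs))"

fun xor_sum :: "bool list \<Rightarrow> bool" where
  "xor_sum [] = False"
| "xor_sum (b # bs) = (b \<noteq> xor_sum bs)"

definition corrl :: "int list \<Rightarrow> nat \<Rightarrow> int" where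
  "corrl xs k = sum_list (map2 (*) xs (rotate k xs))"

text \<open>The parity of an autocorrelation depends on the support alone
  (\<open>corrp_odd\<close>), so it can be tested before any signs are chosen.\<close>

definition corrp :: "bool list \<Rightarrow> nat \<Rightarrow> bool" where
  "corrp bs k = xor_sum (map2 (\<and>) bs (rotate k bs))"

lemma supports_complete: "length (filter id bs) = w \<Longrightarrow> bs \<in> set (supports (length bs) w)"
  by (induction bs arbitrary: w) (auto split: nat.splits)

lemma signings_complete:
  "set xs \<subseteq> {-1, 0, 1} \<Longrightarrow> xs \<in> set (signings (map odd xs))"
  by (induction xs) auto

lemma odd_sum_list: "odd (sum_list xs) = xor_sum (map odd xs)" for xs :: "int list"
  by (induction xs) auto

lemma corrp_odd: "corrp (map odd xs) k = odd (corrl xs k)" for xs :: "int list"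
  by (auto simp: corrp_def corrl_def odd_sum_list rotate_map map2_map_map zip_map_map
      intro!: arg_cong[of _ _ xor_sum])

lemma acorr_corrl: "acorr n f k = corrl (map f [0..<n]) k"
proof -
  have "corrl (map f [0..<n]) k = (\<Sum>i = 0..<n. map2 (*) (map f [0..<n]) (rotate k (map f [0..<n])) ! i)"
    by (simp add: corrl_def sum_list_sum_nth)
  also have "\<dots> = (\<Sum>i = 0..<n. f i * f ((i + k) mod n))"
    by (intro sum.cong) (simp_all add: nth_rotate add.commute)
  finally show ?thesis by (simp add: acorr_def atLeast0LessThan)
qed

lemma weight_filter_odd:
  assumes "set xs \<subseteq> {-1, 0, 1 :: int}"
  shows "int (length (filter id (map odd xs))) = sum_list (map (\<lambda>x. x*x) xs)"
  using assms by (induction xs) auto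

text \<open>This excludes vanishing autocorrelations at weight 4, the one candidate left by
  \<open>candidates_4_2\<close>; parities already suffice.\<close>

lemma no_even_4_support:
  "list_all (\<lambda>b. \<not> (\<not> corrp b 1 \<and> \<not> corrp b 2 \<and> \<not> corrp b 3 \<and> \<not> corrp b 4 \<and> \<not> corrp b 5)) (supports 11 4)"
  by code_simp

text \<open>The only autocorrelations of weight 6 that pass the tests of \<open>candidates\<close> and would violate the bound
  (the product would be 52082718). They form an orbit under \<open>k \<mapsto> 2 k\<close>.\<close>

definition bad_corrs :: "int list list" where
  "bad_corrs = [[-1,1,0,-1,0], [1,-1,0,0,-1], [-1,0,-1,0,1], [0,-1,-1,1,0], [0,0,1,-1,-1]]"

text \<open>The parity test comes first, so the 64 sign patterns are tried only on supports of
  weight 6 that pass it.\<close>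

definition has_corr :: "int list \<Rightarrow> bool" where
  "has_corr d = list_ex (\<lambda>b. corrp b 1 = odd (d ! 0) \<and> corrp b 2 = odd (d ! 1) \<and> corrp b 3 = odd (d ! 2)
     \<and> corrp b 4 = odd (d ! 3) \<and> corrp b 5 = odd (d ! 4)
     \<and> list_ex (\<lambda>xs. corrl xs 1 = d ! 0 \<and> corrl xs 2 = d ! 1 \<and> corrl xs 3 = d ! 2
         \<and> corrl xs 4 = d ! 3 \<and> corrl xs 5 = d ! 4) (signings b)) (supports 11 6)"

lemma no_bad_corr: "list_all (\<lambda>d. \<not> has_corr d) bad_corrs"
  by code_simp

definition odds :: "int list \<Rightarrow> nat" where
  "odds xs = length (filter odd xs)"

text \<open>Here \<open>738335433600 = 120\<^sup>2 * 51273294\<close>.\<close>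

definition pairs_ok :: "(int list \<times> int) list \<Rightarrow> (int list \<times> int) list \<Rightarrow> bool" where
  "pairs_ok L L' = list_all (\<lambda>(c, v). odds c = 2 \<and> list_all (\<lambda>(d, w).
     \<not> (v * w > 738335433600 \<and> list_all2 (\<lambda>x y. odd x \<noteq> odd y) c d) \<or> list_ex (\<lambda>e. d = e) bad_corrs) L') L"

text \<open>Weights 5 and 6. For each sum \<open>t\<close> the third number is
  \<open>T = (t*t - s) / 2\<close> and the fourth a Maclaurin cutoff admissible in
  \<open>candidates_complete\<close>. All candidates of weight 5 have two odd autocorrelations, so a
  partner of opposite parity has three.\<close>

lemma pairs_ok_candidates:
  "pairs_ok
     (candidates (\<lambda>_. True) 5 1 (-2) 10 2799 @ candidates (\<lambda>_. True) 5 3 2 11 2799)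
     (candidates (\<lambda>d. odds d = 3) 6 2 (-1) 19 8299 @ candidates (\<lambda>d. odds d = 3) 6 4 5 11 8299)"
  by code_simp

text \<open>Here all power spectrum values would be 4 and the determinant
  \<open>2 * 4^5 = 2048\<close>, the equality case of AM-GM.\<close>

lemma candidates_4_2: "candidates (\<lambda>_. True) 4 2 0 5 1176 = [([0,0,0,0,0], 245760)]"
  by code_simp

text \<open>AM-GM bounds \<open>10\<^sup>5\<close> times the determinant by \<open>t * (11 s - t\<^sup>2)\<^sup>5\<close>. The cases left open by the product of the two
  bounds are treated by the candidate lists, with the thresholds 1176, 2799 and 8299: a factor below its
  threshold is settled by the AM-GM bound of the other factor.\<close>

definition small_bound :: "int \<Rightarrow> int \<Rightarrow> int \<Rightarrow> bool" where
  "small_bound s t t' = (t * (11*s - t*t)^5 * (t' * (11*(11-s) - t'*t')^5) < 512732950000000000)"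

text \<open>\<open>s\<close> is the smaller of the two weights. The two congruences describe
  parities that cannot occur, as \<open>det_pair_le_aux\<close> shows.\<close>

lemma small_bound_table:
  "list_all (\<lambda>s. list_all (\<lambda>t. list_all (\<lambda>t'.
     (s + t) mod 2 = 1 \<or> (11 - s + t') mod 2 = 1 \<or> small_bound s t t'
       \<or> s = 4 \<and> t = 2 \<and> (t' = 1 \<or> t' = 3) \<or> s = 5 \<and> (t = 1 \<or> t = 3) \<and> (t' = 2 \<or> t' = 4))
     [0,1,2,3,4,5,6,7,8,9,10,11]) [0,1,2,3,4,5]) [0,1,2,3,4,5]"
  by code_simp

section \<open>Ternary pairs of order 11 with complementary supports\<close>

lemma ternary_values:
  fixes f g :: "nat \<Rightarrow> int"
  assumes "(f i)\<^sup>2 + (g i)\<^sup>2 = 1"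
  shows "f i \<in> {-1, 0, 1}"
proof -
  have "(f i)\<^sup>2 \<le> 1" using assms zero_le_power2[of "g i"] by linarith
  then have "\<bar>f i\<bar> \<le> 1" by (simp add: abs_square_le_1)
  then show ?thesis by auto
qed

lemma abs_sum_le_acorr:
  fixes f :: "nat \<Rightarrow> int"
  assumes "\<And>i. i < n \<Longrightarrow> f i \<in> {-1, 0, 1}"
  shows "\<bar>\<Sum>i<n. f i\<bar> \<le> acorr n f 0"
proof -
  have "\<bar>\<Sum>i<n. f i\<bar> \<le> (\<Sum>i<n. \<bar>f i\<bar>)" by (rule sum_abs)
  also have "\<dots> = (\<Sum>i<n. (f i)\<^sup>2)"
    using assms by (intro sum.cong refl) (metis abs_0 abs_1 abs_minus_cancel empty_iff insert_iff lessThan_iff one_power2 power2_minus zero_power2)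
  finally show ?thesis by (simp add: acorr_0)
qed

lemma corr_list_corrl: "corr_list f = map (corrl (map f [0..<11])) [1,2,3,4,5]"
  by (simp add: corr_list_def acorr_corrl)

lemma support_11:
  fixes f :: "nat \<Rightarrow> int"
  assumes f: "\<And>i. i < 11 \<Longrightarrow> f i \<in> {-1, 0, 1}" and s: "acorr 11 f 0 = int w"
  defines "xs \<equiv> map f [0..<11]"
  shows "map odd xs \<in> set (supports 11 w)" "xs \<in> set (signings (map odd xs))"
proof -
  have ter: "set xs \<subseteq> {-1, 0, 1}"
  proof
    fix x assume "x \<in> set xs"
    then obtain i where "i < 11" "x = f i" by (auto simp: xs_def)
    then show "x \<in> {-1, 0, 1}" using f by blast
  qed
  then show "xs \<in> set (signings (map odd xs))" by (rule signings_complete)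
  have "acorr 11 f 0 = sum_list (map (\<lambda>x. x*x) xs)"
    unfolding xs_def by (simp add: acorr_0 interv_sum_list_conv_sum_set_nat o_def power2_eq_square atLeast0LessThan)
  then have "length (filter id (map odd xs)) = w"
    using weight_filter_odd[OF ter] s by simp
  then show "map odd xs \<in> set (supports 11 w)"
    using supports_complete[of "map odd xs" w] by (simp add: xs_def)
qed

lemma corr_list_4_nonzero:
  fixes f :: "nat \<Rightarrow> int"
  assumes "\<And>i. i < 11 \<Longrightarrow> f i \<in> {-1, 0, 1}" "acorr 11 f 0 = 4"
  shows "corr_list f \<noteq> [0,0,0,0,0]"
proof
  assume "corr_list f = [0,0,0,0,0]"
  then have "\<not> corrp (map odd (map f [0..<11])) k" if "k \<in> {1,2,3,4,5}" for k
    unfolding corrp_odd using that by (auto simp: corr_list_corrl)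
  then show False
    using support_11(1)[of f 4] assms no_even_4_support by (auto simp: list_all_iff)
qed

text \<open>The sequence itself and its support would be witnesses in the search
  \<open>has_corr\<close>, which fails on every list in \<open>bad_corrs\<close>.\<close>

lemma corr_list_6_not_bad:
  fixes f :: "nat \<Rightarrow> int"
  assumes f: "\<And>i. i < 11 \<Longrightarrow> f i \<in> {-1, 0, 1}" "acorr 11 f 0 = 6"
  shows "corr_list f \<notin> set bad_corrs"
proof
  assume bad: "corr_list f \<in> set bad_corrs"
  let ?xs = "map f [0..<11]"
  have "has_corr (corr_list f)"
    unfolding has_corr_def list_ex_iff
    by (intro bexI[of _ "map odd ?xs"] bexI[of _ ?xs] conjI corrp_odd[THEN trans] arg_cong[of _ _ odd]
        support_11[of f 6]) (use f in \<open>simp_all add: corr_list_corrl\<close>)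
  then show False using no_bad_corr bad by (auto simp: list_all_iff)
qed

text \<open>The bound is \<open>215055782117376 / 4 ^ 11\<close>. The weights of \<open>f\<close>
  and \<open>g\<close> are \<open>s\<close> and \<open>11 - s\<close>. The product of the two AM-GM
  bounds settles everything except some sums at weights 4 and 7 or 5 and 6.\<close>

lemma det_pair_le_aux:
  fixes f g :: "nat \<Rightarrow> int"
  assumes fg: "\<And>i. i < 11 \<Longrightarrow> (f i)\<^sup>2 + (g i)\<^sup>2 = 1" and s5: "acorr 11 f 0 \<le> 5"
  shows "\<bar>det (circ (vec 11 f))\<bar> * \<bar>det (circ (vec 11 g))\<bar> \<le> 51273294"
proof -
  define s where "s = acorr 11 f 0"
  define t where "t = \<bar>\<Sum>i<11. f i\<bar>"
  define t' where "t' = \<bar>\<Sum>i<11. g i\<bar>"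
  define D where "D = \<bar>det (circ (vec 11 f))\<bar>"
  define D' where "D' = \<bar>det (circ (vec 11 g))\<bar>"
  have f: "f i \<in> {-1, 0, 1}" if "i < 11" for i using ternary_values fg[OF that] by blast
  have g: "g i \<in> {-1, 0, 1}" if "i < 11" for i
    using ternary_values[of g i f] fg[OF that] by (simp add: add.commute)
  have "acorr 11 f 0 + acorr 11 g 0 = (\<Sum>i<11::nat. 1)"
    unfolding acorr_0 sum.distrib[symmetric] using fg by (intro sum.cong) auto
  then have s': "acorr 11 g 0 = 11 - s" by (simp add: s_def)
  have st: "0 \<le> t" "t \<le> s" "0 \<le> t'" "t' \<le> 11 - s"
    using abs_sum_le_acorr[of 11 f] abs_sum_le_acorr[of 11 g] f g
    by (simp_all add: t_def t'_def s_def flip: s'[unfolded s_def])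
  have tT: "t*t = s + 2 * sum_list (corr_list f)" "t'*t' = 11 - s + 2 * sum_list (corr_list g)"
    using sum_sq_11[of f] sum_sq_11[of g] by (simp_all add: t_def t'_def s_def s' power2_eq_square)
  have el1: "el1 (corr5 h) = - sum_list (corr_list h)" for h
    by (simp add: corr_list_def corr5_def)
  have D0: "0 \<le> D" "0 \<le> D'" by (simp_all add: D_def D'_def)
  have bnd: "100000 * D \<le> t * (11*s - t*t)^5"
  proof -
    define w where "w = 5*s - sum_list (corr_list f)"
    have "3125 * D \<le> t * w^5"
      using det_circ_11_le(1)[of f] by (simp add: el1 D_def t_def s_def w_def)
    then have "100000 * D \<le> t * (32 * w^5)" by simp
    \<comment> \<open>Doubling the base clears the halved autocorrelation sum:
      \<open>2 * (5*s - T) = 11*s - t*t\<close>, as \<open>t*t = s + 2*T\<close>.\<close>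
    also have "32 * w^5 = (2 * w)^5" by (simp only: power_mult_distrib) simp
    also have "2 * w = 11*s - t*t" using tT(1) by (simp add: w_def)
    finally show ?thesis .
  qed
  have bnd': "100000 * D' \<le> t' * (11*(11-s) - t'*t')^5"
  proof -
    define w where "w = 5*(11-s) - sum_list (corr_list g)"
    have "3125 * D' \<le> t' * w^5"
      using det_circ_11_le(1)[of g] by (simp add: el1 D'_def t'_def s' w_def)
    then have "100000 * D' \<le> t' * (32 * w^5)" by simp
    also have "32 * w^5 = (2 * w)^5" by (simp only: power_mult_distrib) simp
    also have "2 * w = 11*(11-s) - t'*t'" using tT(2) by (simp add: w_def)
    finally show ?thesis .
  qed
  have "s \<in> set [0,1,2,3,4,5]" "t \<in> set [0,1,2,3,4,5]" "t' \<in> set [0,1,2,3,4,5,6,7,8,9,10,11]"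
    using st s5 unfolding s_def[symmetric] by (simp_all, presburger+)
  then have "(s + t) mod 2 = 1 \<or> (11 - s + t') mod 2 = 1 \<or> small_bound s t t'
       \<or> s = 4 \<and> t = 2 \<and> (t' = 1 \<or> t' = 3) \<or> s = 5 \<and> (t = 1 \<or> t = 3) \<and> (t' = 2 \<or> t' = 4)"
    using small_bound_table unfolding list_all_iff by blast
  \<comment> \<open>\<open>t*t\<close> and \<open>s\<close> differ by twice the autocorrelation sum,
    so \<open>t\<close> and \<open>s\<close> have equal parity.\<close>
  moreover have "(s + t) mod 2 \<noteq> 1"
  proof
    assume "(s + t) mod 2 = 1"
    then have "odd (s + t)" by presburger
    then have "odd (s + t*t)" by simp
    then show False using tT(1) by simp
  qed
  moreover have "(11 - s + t') mod 2 \<noteq> 1"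
  proof
    assume "(11 - s + t') mod 2 = 1"
    then have "odd (11 - s + t')" by presburger
    then have "odd (11 - s + t'*t')" by simp
    then show False using tT(2) by simp
  qed
  ultimately consider (small) "small_bound s t t'" | (four) "s = 4" "t = 2" "t' = 1 \<or> t' = 3"
    | (five) "s = 5" "t = 1 \<or> t = 3" "t' = 2 \<or> t' = 4" by blast
  then have "D * D' \<le> 51273294"
  proof cases
    case small
    have "(100000 * D) * (100000 * D') \<le> (t * (11*s - t*t)^5) * (t' * (11*(11-s) - t'*t')^5)"
    proof (rule mult_mono[OF bnd bnd'])
      show "0 \<le> t * (11*s - t*t)^5" using bnd D0(1) by linarith
      show "0 \<le> 100000 * D'" using D0(2) by simp
    qed
    \<comment> \<open>The constant is \<open>10^10 * 51273295\<close>; by integrality the strict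
      inequality gives the bound 51273294.\<close>
    also have "\<dots> < 512732950000000000" using small by (simp add: small_bound_def)
    finally show ?thesis by (simp add: mult.commute)
  next
    case four
    have "D \<le> 1175"
    proof (rule ccontr)
      assume "\<not> D \<le> 1175"
      then have "(corr_list f, 120*D) \<in> set (candidates (\<lambda>_. True) 4 2 0 5 1176)"
        unfolding D_def using four s_def t_def
        by (intro candidates_complete) (simp_all add: D_def)
      then show False
        using corr_list_4_nonzero[of f] f four(1) by (simp add: candidates_4_2 s_def)
    qed
    \<comment> \<open>The AM-GM bound of the weight 7 factor, largest at
      \<open>t' = 3\<close>.\<close>
    moreover have "D' \<le> 43618" using four(1,3) bnd' by auto
    ultimately have "D * D' \<le> 1175 * 43618" using D0 by (intro mult_mono) auto
    then show ?thesis by simp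
  next
    case five
    \<comment> \<open>AM-GM bounds of both factors, attained as rounded values at
      \<open>t = 3\<close> and \<open>t' = 2\<close>. They settle the case of one factor below its
      threshold.\<close>
    have Df: "D \<le> 6178" using five(1,2) bnd by auto
    have Dg: "D' \<le> 18322" using five(1,3) bnd' by auto
    show ?thesis
    proof (cases "D \<le> 2798 \<or> D' \<le> 8298")
      case True
      then show ?thesis
      proof
        assume "D \<le> 2798"
        then have "D * D' \<le> 2798 * 18322" using Dg D0 by (intro mult_mono) auto
        then show ?thesis by simp
      next
        assume "D' \<le> 8298"
        then have "D * D' \<le> 6178 * 8298" using Df D0 by (intro mult_mono) auto
        then show ?thesis by simp
      qed
    next
      case False
      define L where "L = candidates (\<lambda>_. True) 5 1 (-2) 10 2799 @ candidates (\<lambda>_. True) 5 3 2 11 2799"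
      define L' where "L' = candidates (\<lambda>d. odds d = 3) 6 2 (-1) 19 8299 @ candidates (\<lambda>d. odds d = 3) 6 4 5 11 8299"
      note ok = pairs_ok_candidates[folded L_def L'_def, unfolded pairs_ok_def list_all_iff]
      have L: "(corr_list f, 120*D) \<in> set L"
      proof -
        have "(corr_list f, 120*D) \<in> set (candidates (\<lambda>_. True) 5 1 (-2) 10 2799)" if "t = 1"
          unfolding D_def using five(1) that s_def t_def False
          by (intro candidates_complete) (simp_all add: D_def)
        moreover have "(corr_list f, 120*D) \<in> set (candidates (\<lambda>_. True) 5 3 2 11 2799)" if "t = 3"
          unfolding D_def using five(1) that s_def t_def False
          by (intro candidates_complete) (simp_all add: D_def)
        ultimately show ?thesis using five(2) by (auto simp: L_def)
      qed
      have opp: "list_all2 (\<lambda>x y. odd x \<noteq> odd y) (corr_list f) (corr_list g)"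
      proof -
        have "odd (acorr 11 f k) \<noteq> odd (acorr 11 g k)" for k
          using odd_acorr_complement[of 11 f g k] fg by auto
        then show ?thesis by (simp add: corr_list_def)
      qed
      \<comment> \<open>The computed list forces two odd autocorrelations of \<open>f\<close>. At
        each of the five lags exactly one of \<open>f\<close> and \<open>g\<close> is odd, so
        \<open>g\<close> has three, as the filter for its candidates requires.\<close>
      have "odds (corr_list f) = 2" using ok L by fast
      moreover have "odds (corr_list f) + odds (corr_list g) = 5"
        using opp by (simp add: corr_list_def odds_def)
      ultimately have o3: "odds (corr_list g) = 3" by simp
      have L': "(corr_list g, 120*D') \<in> set L'"
      proof -
        have "(corr_list g, 120*D') \<in> set (candidates (\<lambda>d. odds d = 3) 6 2 (-1) 19 8299)" if "t' = 2"
          unfolding D'_def using five(1) that s' t'_def False o3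
          by (intro candidates_complete) (simp_all add: D'_def)
        moreover have "(corr_list g, 120*D') \<in> set (candidates (\<lambda>d. odds d = 3) 6 4 5 11 8299)" if "t' = 4"
          unfolding D'_def using five(1) that s' t'_def False o3
          by (intro candidates_complete) (simp_all add: D'_def)
        ultimately show ?thesis using five(3) by (auto simp: L'_def)
      qed
      have "acorr 11 g 0 = 6" using s' five(1) by simp
      then have "corr_list g \<notin> set bad_corrs" using corr_list_6_not_bad[of g] g by blast
      then have "\<not> (120*D) * (120*D') > 738335433600"
        using ok L L' opp unfolding list_ex_iff by fast
      then show ?thesis by (simp add: mult.commute)
    qed
  qed
  then show ?thesis by (simp add: D_def D'_def)
qed

text \<open>The two weights add up to 11, so one of them is at most 5, and the claim is
  symmetric.\<close>

lemma det_pair_le: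
  fixes f g :: "nat \<Rightarrow> int"
  assumes fg: "\<And>i. i < 11 \<Longrightarrow> (f i)\<^sup>2 + (g i)\<^sup>2 = 1"
  shows "\<bar>det (circ (vec 11 f))\<bar> * \<bar>det (circ (vec 11 g))\<bar> \<le> 51273294"
proof -
  have "acorr 11 f 0 + acorr 11 g 0 = (\<Sum>i<11::nat. 1)"
    unfolding acorr_0 sum.distrib[symmetric] using fg by (intro sum.cong) auto
  then consider "acorr 11 f 0 \<le> 5" | "acorr 11 g 0 \<le> 5" by fastforce
  then show ?thesis
  proof cases
    case 1
    then show ?thesis using fg by (intro det_pair_le_aux)
  next
    case 2
    then show ?thesis using det_pair_le_aux[of g f] fg by (simp add: mult.commute add.commute)
  qed
qed

section \<open>Orders 5, 9 and 10\<close>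

text \<open>The row sum times the product of the two power spectrum values, expressed by the
  autocorrelations \<open>s\<close>, \<open>c\<close>, \<open>d\<close>. The formula is rational, so
  it can be evaluated over the integers.\<close>

definition det5 :: "'a::comm_ring_1 \<Rightarrow> 'a \<Rightarrow> 'a \<Rightarrow> 'a \<Rightarrow> 'a \<Rightarrow> 'a" where
  "det5 x0 x1 x2 x3 x4 =
    (let s = x0*x0 + x1*x1 + x2*x2 + x3*x3 + x4*x4;
         c = x0*x1 + x1*x2 + x2*x3 + x3*x4 + x4*x0;
         d = x0*x2 + x1*x3 + x2*x4 + x3*x0 + x4*x1
     in (x0+x1+x2+x3+x4) * (s*s - s*(c + d) - c*c - d*d + 3*(c*d)))"

text \<open>The factors are the row sum, the power spectrum at frequency 3, and the product over the
  frequencies 1, 2, 4. The last is a norm from the cubic field generated by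
  \<open>2 * cos (2 * pi / 9)\<close>; lag 3 has cosine factor -1 there, hence
  \<open>u = r0 - r3\<close>.\<close>

definition det9_of_corr :: "'a::comm_ring_1 \<Rightarrow> 'a \<Rightarrow> 'a \<Rightarrow> 'a \<Rightarrow> 'a \<Rightarrow> 'a \<Rightarrow> 'a" where
  "det9_of_corr t r0 x y r3 z = (let u = r0 - r3 in
     t * (r0 - x - y + 2*r3 - z) *
       (u*u*u - 3*(u*(x*x + y*y + z*z - x*y - y*z - z*x)) - (x*x*x + y*y*y + z*z*z) - 6*(x*y*z)
         + 6*(x*x*y + y*y*z + z*z*x) - 3*(x*y*y + y*z*z + z*x*x)))"

definition det9 :: "'a::comm_ring_1 \<Rightarrow> 'a \<Rightarrow> 'a \<Rightarrow> 'a \<Rightarrow> 'a \<Rightarrow> 'a \<Rightarrow> 'a \<Rightarrow> 'a \<Rightarrow> 'a \<Rightarrow> 'a" where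
  "det9 x0 x1 x2 x3 x4 x5 x6 x7 x8 = det9_of_corr
     (x0+x1+x2+x3+x4+x5+x6+x7+x8)
     (x0*x0 + x1*x1 + x2*x2 + x3*x3 + x4*x4 + x5*x5 + x6*x6 + x7*x7 + x8*x8)
     (x0*x1 + x1*x2 + x2*x3 + x3*x4 + x4*x5 + x5*x6 + x6*x7 + x7*x8 + x8*x0)
     (x0*x2 + x1*x3 + x2*x4 + x3*x5 + x4*x6 + x5*x7 + x6*x8 + x7*x0 + x8*x1)
     (x0*x3 + x1*x4 + x2*x5 + x3*x6 + x4*x7 + x5*x8 + x6*x0 + x7*x1 + x8*x2)
     (x0*x4 + x1*x5 + x2*x6 + x3*x7 + x4*x8 + x5*x0 + x6*x1 + x7*x2 + x8*x3)"

lemma C_values: "n > 0 \<Longrightarrow> C n j k = C n 1 ((j * k) mod n)"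
  using C_1[of n j k] C_mod[of n 1 "j * k"] by simp

lemma sum_1_2: "(\<Sum>k = 1..2. g k) = g 1 + g 2"
  for g :: "nat \<Rightarrow> 'a::comm_monoid_add"
  by (simp add: eval_nat_numeral add_ac)

lemma prod_1_2: "(\<Prod>k = 1..2. g k) = g 1 * g 2"
  for g :: "nat \<Rightarrow> 'a::comm_monoid_mult"
  by (simp add: eval_nat_numeral mult_ac)

lemma sum_1_4: "(\<Sum>k = 1..4. g k) = g 1 + g 2 + g 3 + g 4"
  for g :: "nat \<Rightarrow> 'a::comm_monoid_add"
  by (simp add: eval_nat_numeral add_ac)

lemma prod_1_4: "(\<Prod>k = 1..4. g k) = g 1 * g 2 * g 3 * g 4"
  for g :: "nat \<Rightarrow> 'a::comm_monoid_mult"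
  by (simp add: eval_nat_numeral mult_ac)

lemma lessThan_expand:
  "{..<5::nat} = {0,1,2,3,4}" "{..<9::nat} = {0,1,2,3,4,5,6,7,8}"
  unfolding atLeast_upt by (simp_all add: upt_rec eval_nat_numeral)

lemma det_circ_5:
  fixes f :: "nat \<Rightarrow> real"
  shows "det (circ (vec 5 f)) = det5 (f 0) (f 1) (f 2) (f 3) (f 4)"
proof -
  define a b where "a = C 5 1 1" and "b = C 5 1 2"
  define s c d where "s = acorr 5 f 0" and "c = acorr 5 f 1" and "d = acorr 5 f 2"
  have C: "C 5 1 1 = a" "C 5 1 2 = b" "C 5 2 1 = b" "C 5 2 2 = a"
    using C_values[of 5 2 1] C_values[of 5 2 2] C_reflect[of 5 1 1] by (simp_all add: a_def b_def)
  \<comment> \<open>\<open>a\<close> and \<open>b\<close> are the roots of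
    \<open>X^2 + X - 1\<close>; sum and product determine the symmetric expression below.\<close>
  have ab: "a + b = -1" using sum_C[of 5 2 1, unfolded sum_1_2] by (simp add: a_def b_def)
  have "a * b = C 5 1 3 + C 5 1 1" unfolding a_def b_def by (simp add: C_mult eval_nat_numeral)
  also have "C 5 1 3 = b" using C_reflect[of 5 2 1] by (simp add: b_def)
  finally have ab': "a * b = -1" using ab by (simp add: a_def)
  have "det (circ (vec 5 f)) = (\<Sum>k<5. f k) * (psd 5 f 1 * psd 5 f 2)"
    using det_circ_odd[of 5 2 f] by (simp add: prod_1_2 del: One_nat_def)
  also have "psd 5 f 1 = s + c*a + d*b"
    using psd_C[of 5 f 1] by (simp add: sum_1_2 C s_def c_def d_def del: One_nat_def)
  also have "psd 5 f 2 = s + c*b + d*a"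
    using psd_C[of 5 f 2] by (simp add: sum_1_2 C s_def c_def d_def del: One_nat_def)
  also have "(s + c*a + d*b) * (s + c*b + d*a) = s*s - s*(c + d) - c*c - d*d + 3*(c*d)"
  proof -
    have "(s + c*a + d*b) * (s + c*b + d*a) =
        s*s + s*(c + d)*(a + b) + (c*c + d*d)*(a*b) + c*d*((a + b)*(a + b) - 2*(a*b))"
      by (simp add: algebra_simps)
    then show ?thesis by (simp add: ab ab')
  qed
  also have "s = f 0*f 0 + f 1*f 1 + f 2*f 2 + f 3*f 3 + f 4*f 4"
    by (simp add: s_def acorr_def lessThan_expand flip: numeral_2_eq_2)
  also have "c = f 0*f 1 + f 1*f 2 + f 2*f 3 + f 3*f 4 + f 4*f 0"
    by (simp add: c_def acorr_def lessThan_expand flip: numeral_2_eq_2)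
  also have "d = f 0*f 2 + f 1*f 3 + f 2*f 4 + f 3*f 0 + f 4*f 1"
    by (simp add: d_def acorr_def lessThan_expand flip: numeral_2_eq_2)
  also have "(\<Sum>k<5. f k) = f 0 + f 1 + f 2 + f 3 + f 4" by (simp add: lessThan_expand)
  finally show ?thesis by (simp only: det5_def Let_def)
qed

lemma det_circ_9:
  fixes f :: "nat \<Rightarrow> real"
  shows "det (circ (vec 9 f)) = det9 (f 0) (f 1) (f 2) (f 3) (f 4) (f 5) (f 6) (f 7) (f 8)"
proof -
  define a b d where "a = C 9 1 1" and "b = C 9 1 2" and "d = C 9 1 4"
  define r0 x y r3 z where "r0 = acorr 9 f 0" and "x = acorr 9 f 1" and "y = acorr 9 f 2"
    and "r3 = acorr 9 f 3" and "z = acorr 9 f 4"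
  have C3: "C 9 1 3 = -1" using cos_120 by (simp add: C_def)
  have R: "C 9 1 5 = d" "C 9 1 6 = -1" "C 9 1 7 = b" "C 9 1 8 = a"
    using C_reflect[of 9 4 1] C_reflect[of 9 3 1] C_reflect[of 9 2 1] C_reflect[of 9 1 1] C3
    by (simp_all add: a_def b_def d_def)
  have C1: "C 9 1 1 = a" "C 9 1 2 = b" "C 9 1 3 = -1" "C 9 1 4 = d"
    using C3 by (simp_all add: a_def b_def d_def)
  have C2: "C 9 2 1 = b" "C 9 2 2 = d" "C 9 2 3 = -1" "C 9 2 4 = a"
    using C_values[of 9 2 1] C_values[of 9 2 2] C_values[of 9 2 3] C_values[of 9 2 4] R C1 by simp_all
  have C3: "C 9 3 1 = -1" "C 9 3 2 = -1" "C 9 3 3 = 2" "C 9 3 4 = -1"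
    using C_values[of 9 3 1] C_values[of 9 3 2] C_values[of 9 3 3] C_values[of 9 3 4] R C1
    by (simp_all add: C_0)
  have C4: "C 9 4 1 = d" "C 9 4 2 = a" "C 9 4 3 = -1" "C 9 4 4 = b"
    using C_values[of 9 4 1] C_values[of 9 4 2] C_values[of 9 4 3] C_values[of 9 4 4] R C1 by simp_all
  have s: "d = - a - b" using sum_C[of 9 4 1, unfolded sum_1_4] C1 by simp
  have aa: "a * a = b + 2" using C_mult[of 9 1 1 1] C1 by (simp add: C_0 eval_nat_numeral)
  have ab: "a * b = a - 1" using C_mult[of 9 1 1 2] C1 by (simp add: eval_nat_numeral)
  have bb: "b * b = d + 2" using C_mult[of 9 1 2 2] C1 by (simp add: C_0 eval_nat_numeral)
  have dd: "d * d = a + 2" using C_mult[of 9 1 4 4] C1 R by (simp add: C_0)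
  have bd: "b * d = b - 1" using C_mult[of 9 1 2 4] C1 R by simp
  have ad: "a * d = d - 1" using C_mult[of 9 1 1 4] C1 R by (simp add: eval_nat_numeral)
  have sum0: "a + b + d = 0" using s by simp
  \<comment> \<open>\<open>a\<close>, \<open>b\<close>, \<open>d\<close> are the roots of
    \<open>X^3 - 3*X + 1\<close>. The norm is only cyclically symmetric in \<open>x\<close>,
    \<open>y\<close>, \<open>z\<close>, so the cyclic sums \<open>S\<close> and \<open>S'\<close>
    are needed besides the symmetric ones.\<close>
  have S: "a*(a*b) + b*(b*d) + d*(a*d) = 6" and S': "a*(a*d) + b*(a*b) + d*(b*d) = -3"
    and T: "a*(a*a) + b*(b*b) + d*(d*d) = -3" and U: "a*b + b*d + a*d = -3" and V: "d*(a*b) = -1"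
  proof -
    have "a*(a*b) = b + 2 - a" "b*(b*d) = d + 2 - b" "d*(a*d) = a + 2 - d"
      by (simp_all add: ab bd ad right_diff_distrib aa bb dd)
    then show "a*(a*b) + b*(b*d) + d*(a*d) = 6" using sum0 by linarith
    have "a*(a*d) = d - 1 - a" "b*(a*b) = a - 1 - b" "d*(b*d) = b - 1 - d"
      by (simp_all add: ab bd ad right_diff_distrib mult.commute[of b a] mult.commute[of d b])
    then show "a*(a*d) + b*(a*b) + d*(b*d) = -3" using sum0 by linarith
    have "a*(a*a) = a - 1 + 2*a" "b*(b*b) = b - 1 + 2*b" "d*(d*d) = d - 1 + 2*d"
      by (simp_all add: aa bb dd ab bd ad distrib_left mult.commute[of d a])
    then show "a*(a*a) + b*(b*b) + d*(d*d) = -3" using sum0 by linarith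
    show "a*b + b*d + a*d = -3" using sum0 ab bd ad by linarith
    show "d*(a*b) = -1" by (simp add: ab ad right_diff_distrib mult.commute[of d a])
  qed
  have "det (circ (vec 9 f)) = (\<Sum>k<9. f k) * (psd 9 f 1 * psd 9 f 2 * psd 9 f 3 * psd 9 f 4)"
    using det_circ_odd[of 9 4 f] by (simp add: prod_1_4 del: One_nat_def)
  also have "psd 9 f 1 = (r0 - r3) + x*a + y*b + z*d"
    using psd_C[of 9 f 1] by (simp add: sum_1_4 C1 r0_def x_def y_def r3_def z_def del: One_nat_def)
  also have "psd 9 f 2 = (r0 - r3) + x*b + y*d + z*a"
    using psd_C[of 9 f 2] by (simp add: sum_1_4 C2 r0_def x_def y_def r3_def z_def del: One_nat_def)
  also have "psd 9 f 3 = r0 - x - y + 2*r3 - z"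
    using psd_C[of 9 f 3] by (simp add: sum_1_4 C3 r0_def x_def y_def r3_def z_def del: One_nat_def)
  also have "psd 9 f 4 = (r0 - r3) + x*d + y*a + z*b"
    using psd_C[of 9 f 4] by (simp add: sum_1_4 C4 r0_def x_def y_def r3_def z_def del: One_nat_def)
  also have "(\<Sum>k<9. f k) * ((r0 - r3 + x*a + y*b + z*d) * (r0 - r3 + x*b + y*d + z*a)
      * (r0 - x - y + 2*r3 - z) * (r0 - r3 + x*d + y*a + z*b)) =
    (\<Sum>k<9. f k) * (r0 - x - y + 2*r3 - z) *
      (((r0 - r3) + x*a + y*b + z*d) * ((r0 - r3) + x*b + y*d + z*a) * ((r0 - r3) + x*d + y*a + z*b))"
    by (simp only: mult_ac)
  also have "(u + x*a + y*b + z*d) * (u + x*b + y*d + z*a) * (u + x*d + y*a + z*b) =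
      u*u*u - 3*(u*(x*x + y*y + z*z - x*y - y*z - z*x)) - (x*x*x + y*y*y + z*z*z) - 6*(x*y*z)
          + 6*(x*x*y + y*y*z + z*z*x) - 3*(x*y*y + y*z*z + z*x*x)" for u
  proof -
    have "(u + x*a + y*b + z*d) * (u + x*b + y*d + z*a) * (u + x*d + y*a + z*b) =
      u*u*u + u*u*(x + y + z)*(a + b + d) + u*(x*x + y*y + z*z)*(a*b + b*d + a*d)
      + u*(x*y + y*z + z*x)*((a + b + d)*(a + b + d) - (a*b + b*d + a*d))
      + (x*x*x + y*y*y + z*z*z)*(d*(a*b))
      + (x*x*y + y*y*z + z*z*x)*(a*(a*b) + b*(b*d) + d*(a*d))
      + (x*y*y + y*z*z + z*x*x)*(a*(a*d) + b*(a*b) + d*(b*d))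
      + x*y*z*(3*(d*(a*b)) + (a*(a*a) + b*(b*b) + d*(d*d)))"
      by (simp add: algebra_simps)
    then show ?thesis unfolding S S' T U V sum0 by (simp add: algebra_simps)
  qed
  also have "r0 = f 0*f 0 + f 1*f 1 + f 2*f 2 + f 3*f 3 + f 4*f 4 + f 5*f 5 + f 6*f 6 + f 7*f 7 + f 8*f 8"
    by (simp add: r0_def acorr_def lessThan_expand flip: numeral_2_eq_2)
  also have "x = f 0*f 1 + f 1*f 2 + f 2*f 3 + f 3*f 4 + f 4*f 5 + f 5*f 6 + f 6*f 7 + f 7*f 8 + f 8*f 0"
    by (simp add: x_def acorr_def lessThan_expand flip: numeral_2_eq_2)
  also have "y = f 0*f 2 + f 1*f 3 + f 2*f 4 + f 3*f 5 + f 4*f 6 + f 5*f 7 + f 6*f 8 + f 7*f 0 + f 8*f 1"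
    by (simp add: y_def acorr_def lessThan_expand flip: numeral_2_eq_2)
  also have "r3 = f 0*f 3 + f 1*f 4 + f 2*f 5 + f 3*f 6 + f 4*f 7 + f 5*f 8 + f 6*f 0 + f 7*f 1 + f 8*f 2"
    by (simp add: r3_def acorr_def lessThan_expand flip: numeral_2_eq_2)
  also have "z = f 0*f 4 + f 1*f 5 + f 2*f 6 + f 3*f 7 + f 4*f 8 + f 5*f 0 + f 6*f 1 + f 7*f 2 + f 8*f 3"
    by (simp add: z_def acorr_def lessThan_expand flip: numeral_2_eq_2)
  also have "(\<Sum>k<9. f k) = f 0 + f 1 + f 2 + f 3 + f 4 + f 5 + f 6 + f 7 + f 8"
    by (simp add: lessThan_expand)
  finally show ?thesis by (simp only: det9_def det9_of_corr_def Let_def)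
qed

lemma det_circ_10:
  fixes f :: "nat \<Rightarrow> real"
  shows "det (circ (vec 10 f)) = det5 (f 0 + f 5) (f 1 + f 6) (f 2 + f 7) (f 3 + f 8) (f 4 + f 9)
    * det5 (f 0 - f 5) (f 6 - f 1) (f 2 - f 7) (f 8 - f 3) (f 4 - f 9)"
  using det_circ_double_odd[of 5 f] by (simp add: det_circ_5)

section \<open>The maxima over sign matrices\<close>

lemma set_map_upt_subset: "(\<And>i. i < n \<Longrightarrow> f i \<in> S) \<Longrightarrow> set (map f [0..<n]) \<subseteq> S"
  by auto

text \<open>For two signs, one of half sum and half difference is 0 and the other is a sign.\<close>

lemma half_sum_difference:
  fixes x y :: int
  assumes "x \<in> {-1, 1}" "y \<in> {-1, 1}"
  shows "2 * ((x + y) div 2) = x + y" "2 * ((x - y) div 2) = x - y"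
    and "((x + y) div 2)\<^sup>2 + ((x - y) div 2)\<^sup>2 = 1"
  using assms by auto

lemma det_circ_double:
  fixes f :: "nat \<Rightarrow> int"
  shows "det (circ (vec n (\<lambda>i. 2 * f i))) = 2 ^ n * det (circ (vec n f))"
proof -
  have "circ (vec n (\<lambda>i. 2 * f i)) = 2 \<cdot>\<^sub>m circ (vec n f)"
    by (intro eq_matI) (simp_all add: circ_vec_index)
  then show ?thesis by (simp add: det_smult)
qed

text \<open>Both rows from \<open>det_circ_double_odd\<close> are even. Halving them gives ternary
  rows with complementary supports and takes \<open>2 ^ h\<close> out of each determinant.\<close>

lemma det_circ_signs_split:
  fixes b :: "nat \<Rightarrow> int"
  assumes h: "odd h" and b: "\<And>i. i < 2 * h \<Longrightarrow> b i \<in> {-1, 1}"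
  obtains p q where "\<And>i. i < h \<Longrightarrow> (p i)\<^sup>2 + (q i)\<^sup>2 = (1::int)"
    and "det (circ (vec (2 * h) (\<lambda>i. real_of_int (b i))))
      = of_int (2 ^ (2 * h) * (det (circ (vec h p)) * det (circ (vec h q))))"
proof
  define p where "p i = (b i + b (i + h)) div 2" for i
  define q where "q i = (-1) ^ i * ((b i - b (i + h)) div 2)" for i
  note half = half_sum_difference[OF b b]
  show "(p i)\<^sup>2 + (q i)\<^sup>2 = 1" if "i < h" for i
    using half(3)[of i "i + h"] that by (simp add: p_def q_def power_mult_distrib flip: power_mult)
  have P: "vec h (\<lambda>i. real_of_int (b i) + real_of_int (b (i + h))) = vec h (\<lambda>i. real_of_int (2 * p i))"
    using half(1) by (intro eq_vecI) (simp_all add: p_def flip: of_int_add of_int_mult)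
  have "2 * q i = (-1) ^ i * (b i - b (i + h))" if "i < h" for i
    using half(2)[of i "i + h"] that unfolding q_def mult.left_commute[of 2] by simp
  then have "real_of_int (2 * q i) = (-1) ^ i * (real_of_int (b i) - real_of_int (b (i + h)))" if "i < h" for i
    using arg_cong[of "2 * q i" _ real_of_int] that by simp
  then have Q: "vec h (\<lambda>i. (-1) ^ i * (real_of_int (b i) - real_of_int (b (i + h)))) = vec h (\<lambda>i. real_of_int (2 * q i))"
    by (intro eq_vecI) (simp_all only: index_vec dim_vec)
  have "det (circ (vec (2 * h) (\<lambda>i. real_of_int (b i)))) =
      of_int (det (circ (vec h (\<lambda>i. 2 * p i))) * det (circ (vec h (\<lambda>i. 2 * q i))))"
    unfolding det_circ_double_odd[OF h] P Q by (simp only: of_int_mult det_circ_of_int)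
  also have "det (circ (vec h (\<lambda>i. 2 * p i))) * det (circ (vec h (\<lambda>i. 2 * q i)))
      = 2 ^ (2 * h) * (det (circ (vec h p)) * det (circ (vec h q)))"
    unfolding det_circ_double mult_2[of h] power_add by (simp only: mult_ac)
  finally show "det (circ (vec (2 * h) (\<lambda>i. real_of_int (b i))))
      = of_int (2 ^ (2 * h) * (det (circ (vec h p)) * det (circ (vec h q))))" .
qed

lemma det_circ_signs_22_le:
  fixes b :: "nat \<Rightarrow> int"
  assumes "\<And>i. i < 22 \<Longrightarrow> b i \<in> {-1, 1}"
  shows "\<bar>det (circ (vec 22 (\<lambda>i. real_of_int (b i))))\<bar> \<le> 215055782117376"
proof -
  obtain p q where pq: "\<And>i. i < 11 \<Longrightarrow> (p i)\<^sup>2 + (q i)\<^sup>2 = (1::int)"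
    and d: "det (circ (vec 22 (\<lambda>i. real_of_int (b i))))
      = of_int (4194304 * (det (circ (vec 11 p)) * det (circ (vec 11 q))))"
    using det_circ_signs_split[of 11 b] assms by auto
  have "\<bar>4194304 * (det (circ (vec 11 p)) * det (circ (vec 11 q)))\<bar> \<le> 215055782117376"
    using det_pair_le[of p q, OF pq] by (simp add: abs_mult)
  then have "real_of_int \<bar>4194304 * (det (circ (vec 11 p)) * det (circ (vec 11 q)))\<bar> \<le> of_int 215055782117376"
    by (simp only: of_int_le_iff)
  then show ?thesis by (simp only: d of_int_abs of_int_numeral)
qed

lemma det_circ_5_int: "det (circ (vec 5 f)) = det5 (f 0) (f 1) (f 2) (f 3) (f 4)" for f :: "nat \<Rightarrow> int"
proof -
  have "real_of_int (det (circ (vec 5 f))) = of_int (det5 (f 0) (f 1) (f 2) (f 3) (f 4))"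
    unfolding det_circ_of_int det_circ_5 by (simp add: det5_def Let_def)
  then show ?thesis by (simp only: of_int_eq_iff)
qed

definition products_le :: "int \<Rightarrow> int list \<Rightarrow> int list \<Rightarrow> bool" where
  "products_le M L L' = list_all (\<lambda>v. list_all (\<lambda>w. \<bar>v * w\<bar> \<le> M) L') L"

definition det5_list :: "int list \<Rightarrow> int" where
  "det5_list xs = det5 (xs!0) (xs!1) (xs!2) (xs!3) (xs!4)"

text \<open>All pairs of ternary rows of length 5 with complementary supports;
  \<open>22 = 22528 / 4 ^ 5\<close>.\<close>

lemma det5_table:
  "list_all (\<lambda>w. list_all (\<lambda>b. products_le 22 (map det5_list (signings b)) (map det5_list (signings (map Not b))))
     (supports 5 w)) [0,1,2,3,4,5]"
  by code_simp

lemma det_circ_signs_10_le: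
  fixes b :: "nat \<Rightarrow> int"
  assumes "\<And>i. i < 10 \<Longrightarrow> b i \<in> {-1, 1}"
  shows "\<bar>det (circ (vec 10 (\<lambda>i. real_of_int (b i))))\<bar> \<le> 22528"
proof -
  obtain p q where pq: "\<And>i. i < 5 \<Longrightarrow> (p i)\<^sup>2 + (q i)\<^sup>2 = (1::int)"
    and d: "det (circ (vec 10 (\<lambda>i. real_of_int (b i))))
      = of_int (1024 * (det (circ (vec 5 p)) * det (circ (vec 5 q))))"
    using det_circ_signs_split[of 5 b] assms by auto
  define xs ys where "xs = map p [0..<5]" and "ys = map q [0..<5]"
  have p: "p i \<in> {-1, 0, 1}" and q: "q i \<in> {-1, 0, 1}" and opp: "odd (q i) = even (p i)" if "i < 5" for i
  proof -
    show "p i \<in> {-1, 0, 1}" "q i \<in> {-1, 0, 1}"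
      using ternary_values[of p i q] ternary_values[of q i p] pq[OF that] by (simp_all add: add.commute)
    have "odd ((p i)\<^sup>2 + (q i)\<^sup>2)" using pq[OF that] by simp
    then show "odd (q i) = even (p i)" by auto
  qed
  have ter: "set xs \<subseteq> {-1, 0, 1}" "set ys \<subseteq> {-1, 0, 1}"
    unfolding xs_def ys_def by (rule set_map_upt_subset, fact p, rule set_map_upt_subset, fact q)
  have ys: "map odd ys = map Not (map odd xs)"
    using opp by (simp add: xs_def ys_def)
  define w where "w = length (filter id (map odd xs))"
  have "w \<le> 5" using length_filter_le[of id "map odd xs"] by (simp add: w_def xs_def)
  then have "w = 0 \<or> w = 1 \<or> w = 2 \<or> w = 3 \<or> w = 4 \<or> w = 5" by arith
  then have "w \<in> set [0,1,2,3,4,5]" by auto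
  moreover have "map odd xs \<in> set (supports 5 w)"
    using supports_complete[of "map odd xs" w] by (simp add: w_def xs_def)
  ultimately have "products_le 22 (map det5_list (signings (map odd xs))) (map det5_list (signings (map odd ys)))"
    using det5_table unfolding ys list_all_iff by blast
  then have "\<bar>det5_list xs * det5_list ys\<bar> \<le> 22"
    using signings_complete[OF ter(1)] signings_complete[OF ter(2)]
    unfolding products_le_def list_all_iff by simp
  then have "\<bar>1024 * (det (circ (vec 5 p)) * det (circ (vec 5 q)))\<bar> \<le> 22528"
    by (simp add: det_circ_5_int det5_list_def xs_def ys_def abs_mult flip: numeral_2_eq_2)
  then have "real_of_int \<bar>1024 * (det (circ (vec 5 p)) * det (circ (vec 5 q)))\<bar> \<le> of_int 22528"
    by (simp only: of_int_le_iff)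
  then show ?thesis by (simp only: d of_int_abs of_int_numeral)
qed

lemma det9_of_int:
  "real_of_int (det9 x0 x1 x2 x3 x4 x5 x6 x7 x8) = det9 (of_int x0) (of_int x1) (of_int x2)
     (of_int x3) (of_int x4) (of_int x5) (of_int x6) (of_int x7) (of_int x8)"
  by (simp add: det9_def det9_of_corr_def Let_def)

definition det9_list :: "int list \<Rightarrow> int" where
  "det9_list xs = det9 (xs!0) (xs!1) (xs!2) (xs!3) (xs!4) (xs!5) (xs!6) (xs!7) (xs!8)"

text \<open>With full support the signings are the 512 sign rows of length 9.\<close>

lemma det9_table: "list_all (\<lambda>xs. \<bar>det9_list xs\<bar> \<le> 6912) (signings (replicate 9 True))"
  by code_simp

lemma det_circ_signs_9_le:
  fixes b :: "nat \<Rightarrow> int"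
  assumes b: "\<And>i. i < 9 \<Longrightarrow> b i \<in> {-1, 1}"
  shows "\<bar>det (circ (vec 9 (\<lambda>i. real_of_int (b i))))\<bar> \<le> 6912"
proof -
  define xs where "xs = map b [0..<9]"
  have "b i \<in> {-1, 0, 1}" if "i < 9" for i using b[OF that] by blast
  then have ter: "set xs \<subseteq> {-1, 0, 1}" unfolding xs_def by (rule set_map_upt_subset)
  have "odd (b i)" if "i < 9" for i using b[OF that] by auto
  moreover have nth: "xs ! i = b i" if "i < 9" for i using that by (simp add: xs_def)
  ultimately have "map odd xs = replicate 9 True"
    by (intro nth_equalityI) (simp_all add: xs_def)
  then have "xs \<in> set (signings (replicate 9 True))" using signings_complete[OF ter] by (simp only:)
  then have "\<bar>det9_list xs\<bar> \<le> 6912" using det9_table by (simp only: list_all_iff)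
  then have "real_of_int \<bar>det9_list xs\<bar> \<le> of_int 6912" by (simp only: of_int_le_iff)
  moreover have "real_of_int (det9_list xs) = det (circ (vec 9 (\<lambda>i. real_of_int (b i))))"
    unfolding det_circ_9 det9_of_int[symmetric] by (simp add: det9_list_def nth)
  ultimately show ?thesis by (simp only: of_int_abs of_int_numeral)
qed

section \<open>Evaluation of the displayed matrices\<close>

lemma vec_of_list_vec: "length xs = n \<Longrightarrow> vec_of_list xs = vec n (\<lambda>i. xs ! i)"
  using vec_of_list_eq_vec[of xs] by simp

lemma det_circ_list_9:
  fixes x0 :: real
  shows "det (circ (vec_of_list [x0,x1,x2,x3,x4,x5,x6,x7,x8])) = det9 x0 x1 x2 x3 x4 x5 x6 x7 x8"
  by (subst vec_of_list_vec[of _ 9]) (simp_all add: det_circ_9)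

lemma det_circ_list_10:
  fixes x0 :: real
  shows "det (circ (vec_of_list [x0,x1,x2,x3,x4,x5,x6,x7,x8,x9])) =
    det5 (x0 + x5) (x1 + x6) (x2 + x7) (x3 + x8) (x4 + x9)
    * det5 (x0 - x5) (x6 - x1) (x2 - x7) (x8 - x3) (x4 - x9)"
  by (subst vec_of_list_vec[of _ 10]) (simp_all add: det_circ_10)

text \<open>120 times the determinant of the circulant matrix.\<close>

definition det11_list :: "int list \<Rightarrow> int" where
  "det11_list xs = sum_list xs *
     snd (snd (el (corrl xs 0) (corrl xs 1, corrl xs 2, corrl xs 3, corrl xs 4, corrl xs 5)))"

lemma det11_list: "120 * det (circ (vec 11 f)) = det11_list (map f [0..<11])"
  unfolding det_circ_11 det11_list_def corr5_def acorr_corrl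
  by (simp add: interv_sum_list_conv_sum_set_nat atLeast0LessThan)

text \<open>The two factors of order 11, each scaled by 120. For lists of length 22 the result is
  14400 times the determinant.\<close>

definition det22_list :: "int list \<Rightarrow> int" where
  "det22_list xs = det11_list (map (\<lambda>i. xs ! i + xs ! (i + 11)) [0..<11])
     * det11_list (map (\<lambda>i. (if even i then 1 else - 1) * (xs ! i - xs ! (i + 11))) [0..<11])"

lemma det22_list:
  assumes "length xs = 22"
  shows "14400 * det (circ (vec_of_list (map real_of_int xs))) = of_int (det22_list xs)"
proof -
  let ?P = "\<lambda>i. xs ! i + xs ! (i + 11)"
    and ?Q = "\<lambda>i. (if even i then 1 else - 1) * (xs ! i - xs ! (i + 11))"
  have "vec_of_list (map real_of_int xs) = vec 22 (\<lambda>i. real_of_int (xs ! i))"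
    using assms by (subst vec_of_list_vec[of _ 22]) (auto intro!: eq_vecI)
  moreover have "vec 11 (\<lambda>i. real_of_int (xs ! i) + real_of_int (xs ! (i + 11))) = vec 11 (\<lambda>i. real_of_int (?P i))"
    by (intro eq_vecI) simp_all
  moreover have "vec 11 (\<lambda>i. (-1) ^ i * (real_of_int (xs ! i) - real_of_int (xs ! (i + 11)))) = vec 11 (\<lambda>i. real_of_int (?Q i))"
    by (intro eq_vecI) simp_all
  ultimately have "det (circ (vec_of_list (map real_of_int xs))) =
      of_int (det (circ (vec 11 ?P))) * of_int (det (circ (vec 11 ?Q)))"
    using det_circ_double_odd[of 11 "\<lambda>i. real_of_int (xs ! i)"] by (simp only: det_circ_of_int) simp
  then have "14400 * det (circ (vec_of_list (map real_of_int xs))) =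
      of_int ((120 * det (circ (vec 11 ?P))) * (120 * det (circ (vec 11 ?Q))))" by simp
  then show ?thesis by (simp only: det11_list det22_list_def)
qed

definition row22 :: "int \<Rightarrow> int list" where
  "row22 x = [x, -1, 1, 1, -1, -1, -1, -1, -1, -1, -1, 1, 1, -1, 1, -1, 1, -1, 1, 1, -1, -1]"

lemma det22_list_values:
  "det22_list (row22 0) = - 3116293269566760000"
  "det22_list (row22 1) = - 3096803262490214400"
  "det22_list (row22 (-1)) = - 3096803262490214400"
  by code_simp+

lemma det_circ_22_values:
  fixes A :: "real \<Rightarrow> real mat"
  defines "A \<equiv> \<lambda>x. circ (vec_of_list
    [x, -1, 1, 1, -1, -1, -1, -1, -1, -1, -1, 1, 1, -1, 1, -1, 1, -1, 1, 1, -1, -1])"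
  shows "det (A 0) = - 216409254831025" "det (A 1) = - 215055782117376" "det (A (-1)) = - 215055782117376"
  using det22_list[of "row22 0"] det22_list[of "row22 1"] det22_list[of "row22 (-1)"]
  unfolding det22_list_values by (simp_all add: A_def row22_def)

text \<open>The quotient by the square tends to \<open>poly q 0\<close>. It thus suffices to know
  the remainder of each expansion exactly.\<close>

lemma quadratic_remainder_bigo:
  fixes F :: "real \<Rightarrow> real" and q :: "real poly"
  assumes "\<And>\<epsilon>. F \<epsilon> = \<epsilon>\<^sup>2 * poly q \<epsilon>"
  shows "F \<in> O[at 0](\<lambda>\<epsilon>. \<epsilon>\<^sup>2)"
proof (rule bigoI_tendsto)
  have "(poly q \<longlongrightarrow> poly q 0) (at 0)" by (intro isContD poly_isCont)
  moreover have "\<forall>\<^sub>F \<epsilon> in at 0. poly q \<epsilon> = F \<epsilon> / \<epsilon>\<^sup>2"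
    unfolding eventually_at_filter by (simp add: assms)
  ultimately show "((\<lambda>\<epsilon>. F \<epsilon> / \<epsilon>\<^sup>2) \<longlongrightarrow> poly q 0) (at 0)"
    by (rule Lim_transform_eventually)
  show "\<forall>\<^sub>F \<epsilon> in at (0::real). \<epsilon>\<^sup>2 \<noteq> 0"
    unfolding eventually_at_filter by simp
qed

text \<open>The identity is exact, so besides the expansion it yields the determinant at 0, where
  the sign maximum is attained, and at 1.\<close>

lemma det_9_expansion:
  "det (circ (vec_of_list [1 - \<epsilon>, 1, -1, 1, -1, -1, 1, 1, 1])) - (6912 + 4608 * \<epsilon>)
    = \<epsilon>\<^sup>2 * poly [:-1728, -1920, 576, 216, -72, -18, 9, -1:] \<epsilon>" for \<epsilon> :: real
  unfolding det_circ_list_9 by (simp add: det9_def det9_of_corr_def Let_def power2_eq_square algebra_simps)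

lemma det_10_expansion_1:
  "det (circ (vec_of_list [1 - \<epsilon>, -1, 1, 1, -1, -1, -1, -1, -1, -1])) - (- (22528 + 2560 * \<epsilon>))
    = \<epsilon>\<^sup>2 * poly [:19200, -5120, -3840, 2912, -720, 0, 40, -10, 1:] \<epsilon>" for \<epsilon> :: real
  unfolding det_circ_list_10 by (simp add: det5_def Let_def power2_eq_square algebra_simps)

lemma det_10_expansion_2:
  "det (circ (vec_of_list [-1 + \<epsilon>, -1, -1, 1, -1, 1, 1, -1, -1, -1])) - (22528 + 7680 * \<epsilon>)
    = \<epsilon>\<^sup>2 * poly [:-3840, -5760, 2240, -1216, 640, -160, 40, -10, 1:] \<epsilon>" for \<epsilon> :: real
  unfolding det_circ_list_10 by (simp add: det5_def Let_def power2_eq_square algebra_simps)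

lemma det_10_even:
  "det (circ (vec_of_list [x, -1, 1, -1, 1, 1, -1, -1, -1, -1]))
    = poly [:-33489, 0, 13045, 0, -2170, 0, 90, 0, -5, 0, 1:] x" for x :: real
  unfolding det_circ_list_10 by (simp add: det5_def Let_def algebra_simps)

lemma odd_coeff_eq_0: "odd i \<Longrightarrow> coeff [:a, 0, b, 0, c, 0, d, 0, e, 0, g:] i = 0"
  by (auto simp: coeff_pCons split: nat.splits)

section \<open>The sign maxima and the conclusion\<close>

lemma D_pm1_9: "D_pm1 9 = 6912"
proof (rule D_pm1_eqI[where a = "(!) [1, 1, -1, 1, -1, -1, 1, 1, 1]"])
  show "[1, 1, -1, 1, -1, -1, 1, 1, 1 :: real] ! i \<in> {-1, 1}" if "i < 9" for i
  proof -
    have "[1, 1, -1, 1, -1, -1, 1, 1, 1 :: real] ! i \<in> set [1, 1, -1, 1, -1, -1, 1, 1, 1]"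
      using that by (intro nth_mem) simp
    then show ?thesis by auto
  qed
  show "\<bar>det (circ (vec 9 ((!) [1, 1, -1, 1, -1, -1, 1, 1, 1 :: real])))\<bar> = 6912"
    using det_9_expansion[of 0] by (subst (asm) vec_of_list_vec[of _ 9]) simp_all
qed (simp_all add: det_circ_signs_9_le)

lemma D_pm1_10: "D_pm1 10 = 22528"
proof (rule D_pm1_eqI[where a = "(!) [1, -1, 1, 1, -1, -1, -1, -1, -1, -1]"])
  show "[1, -1, 1, 1, -1, -1, -1, -1, -1, -1 :: real] ! i \<in> {-1, 1}" if "i < 10" for i
  proof -
    have "[1, -1, 1, 1, -1, -1, -1, -1, -1, -1 :: real] ! i \<in> set [1, -1, 1, 1, -1, -1, -1, -1, -1, -1]"
      using that by (intro nth_mem) simp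
    then show ?thesis by auto
  qed
  show "\<bar>det (circ (vec 10 ((!) [1, -1, 1, 1, -1, -1, -1, -1, -1, -1 :: real])))\<bar> = 22528"
    using det_10_expansion_1[of 0] by (subst (asm) vec_of_list_vec[of _ 10]) simp_all
qed (simp_all add: det_circ_signs_10_le)

lemma D_pm1_22: "D_pm1 22 = 215055782117376"
proof -
  define xs :: "real list" where "xs = [1, -1, 1, 1, -1, -1, -1, -1, -1, -1, -1, 1, 1, -1, 1, -1, 1, -1, 1, 1, -1, -1]"
  have len: "length xs = 22" by (simp add: xs_def)
  show ?thesis
  proof (rule D_pm1_eqI[where a = "(!) xs"])
    show "xs ! i \<in> {-1, 1}" if "i < 22" for i
    proof -
      have "xs ! i \<in> set xs" using that len by (intro nth_mem) simp
      then show ?thesis by (auto simp: xs_def)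
    qed
    show "\<bar>det (circ (vec 22 ((!) xs)))\<bar> = 215055782117376"
      unfolding vec_of_list_vec[OF len, symmetric] unfolding xs_def det_circ_22_values by simp
  qed (simp_all add: det_circ_signs_22_le)
qed

theorem mainTheorem3:
  shows
    "(let A = (\<lambda>\<epsilon>::real. circ (vec_of_list [1 - \<epsilon>, 1, -1, 1, -1, -1, 1, 1, 1])) in
        (\<lambda>\<epsilon>. det (A \<epsilon>) - (6912 + 4608 * \<epsilon>)) \<in> O[at 0](\<lambda>\<epsilon>. \<epsilon>\<^sup>2) \<and>
        D_pm1 9 = 6912 \<and>
        det (A 1) = 8582 \<and> det (A 1) > 6912) \<and>

     D_pm1 10 = 22528 \<and>
     (\<lambda>\<epsilon>::real. det (circ (vec_of_list [1 - \<epsilon>, -1, 1, 1, -1, -1, -1, -1, -1, -1]))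
        - (- (22528 + 2560 * \<epsilon>))) \<in> O[at 0](\<lambda>\<epsilon>. \<epsilon>\<^sup>2) \<and>
     (\<lambda>\<epsilon>::real. det (circ (vec_of_list [-1 + \<epsilon>, -1, -1, 1, -1, 1, 1, -1, -1, -1]))
        - (22528 + 7680 * \<epsilon>)) \<in> O[at 0](\<lambda>\<epsilon>. \<epsilon>\<^sup>2) \<and>
     (let A = (\<lambda>x::real. circ (vec_of_list [x, -1, 1, -1, 1, 1, -1, -1, -1, -1])) in
        (\<exists>p :: real poly. (\<forall>x. det (A x) = poly p x) \<and> (\<forall>i. odd i \<longrightarrow> coeff p i = 0)) \<and>
        - det (A 0) = 33489 \<and>
        - det (A 0) > - det (A 1) \<and> - det (A 0) > - det (A (-1)) \<and>
        - det (A 1) = 22528 \<and> - det (A (-1)) = 22528 \<and> 22528 = D_pm1 10) \<and>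

     (let A = (\<lambda>x::real. circ (vec_of_list
          [x, -1, 1, 1, -1, -1, -1, -1, -1, -1, -1, 1, 1, -1, 1, -1, 1, -1, 1, 1, -1, -1])) in
        - det (A 0) = 216409254831025 \<and>
        - det (A 0) > - det (A 1) \<and> - det (A 0) > - det (A (-1)) \<and>
        - det (A 1) = 215055782117376 \<and> - det (A (-1)) = 215055782117376 \<and>
        215055782117376 = D_pm1 22) \<and>

     (\<forall>n \<in> {9, 10, 22}. \<exists>M \<in> (\<lambda>a. \<bar>det (circ a)\<bar>) ` cube n.
        (\<forall>y \<in> (\<lambda>a. \<bar>det (circ a)\<bar>) ` cube n. y \<le> M) \<and>
        M > D_pm1 n \<and>
        (\<forall>a \<in> extreme_points (cube n). \<bar>det (circ a)\<bar> \<noteq> M))"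
proof -
  \<comment> \<open>The first entry stays \<open>1 - 1\<close>, the form it has when the matrix is
    unfolded at 1.\<close>
  have d9: "det (circ (vec_of_list [1 - 1, 1, -1, 1, -1, -1, 1, 1, 1 :: real])) = 8582"
    using det_9_expansion[of 1] by simp
  have d10: "det (circ (vec_of_list [0, -1, 1, -1, 1, 1, -1, -1, -1, -1 :: real])) = -33489"
    "det (circ (vec_of_list [1, -1, 1, -1, 1, 1, -1, -1, -1, -1 :: real])) = -22528"
    "det (circ (vec_of_list [-1, -1, 1, -1, 1, 1, -1, -1, -1, -1 :: real])) = -22528"
    using det_10_even[of 0] det_10_even[of 1] det_10_even[of "-1"] by simp_all
  have even: "\<exists>p :: real poly. (\<forall>x. det (circ (vec_of_list [x, -1, 1, -1, 1, 1, -1, -1, -1, -1])) = poly p x)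
      \<and> (\<forall>i. odd i \<longrightarrow> coeff p i = 0)"
    using det_10_even odd_coeff_eq_0 by blast
  note O = quadratic_remainder_bigo[OF det_9_expansion] quadratic_remainder_bigo[OF det_10_expansion_1]
    quadratic_remainder_bigo[OF det_10_expansion_2]
  have gt: "\<exists>M \<in> (\<lambda>a. \<bar>det (circ a)\<bar>) ` cube n.
        (\<forall>y \<in> (\<lambda>a. \<bar>det (circ a)\<bar>) ` cube n. y \<le> M) \<and>
        M > D_pm1 n \<and>
        (\<forall>a \<in> extreme_points (cube n). \<bar>det (circ a)\<bar> \<noteq> M)" if n: "n \<in> {9, 10, 22}" for n
  proof -
    consider "n = 9" | "n = 10" | "n = 22" using n by blast
    then show ?thesis
    proof cases
      case 1
      show ?thesis unfolding 1
        by (rule max_cube_gt_D_pm1[of _ "[1 - 1, 1, -1, 1, -1, -1, 1, 1, 1]"])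
          (simp_all only: D_pm1_9 d9, simp_all)
    next
      case 2
      show ?thesis unfolding 2
        by (rule max_cube_gt_D_pm1[of _ "[0, -1, 1, -1, 1, 1, -1, -1, -1, -1]"])
          (simp_all only: D_pm1_10 d10, simp_all)
    next
      case 3
      show ?thesis unfolding 3
        by (rule max_cube_gt_D_pm1[of _ "[0, -1, 1, 1, -1, -1, -1, -1, -1, -1, -1, 1, 1, -1, 1, -1, 1, -1, 1, 1, -1, -1]"])
          (simp_all only: D_pm1_22 det_circ_22_values, simp_all)
    qed
  qed
  show ?thesis
    unfolding Let_def d9 d10 det_circ_22_values D_pm1_9 D_pm1_10 D_pm1_22
    by (intro conjI O even ballI gt) simp_all
qed

end
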